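(* Let $(X,\mu,T)$, together with the open sets $\{X_i\}_{i\in\mathcal I}$, be a system as described in the context, satisfying the Ahlfors regularity (of dimension $\delta>0$), uniform mixing, bounded distortion, expanding, and conformality conditions listed there. Let $\psi:\mathbb{N}\to\mathbb{R}_+$ (positive values) satisfy $\lim_{n\to\infty}\psi(n)=0$, and let $f:X\to X$ be piecewise Lipschitz. Assume furthermore that $T\circ f=f\circ T$. If the series $\sum_{n=1}^\infty\psi(n)^\delta$ diverges, then $\mu\big(R_T^f(\psi)\big)=1$, where $$R_T^f(\psi):=\{x\in X: d(T^nx,f(x))<\psi(n)\text{ for infinitely many }n\in\mathbb{N}\}.$$
   Context: $(X,d)$ is a separable compact metric space, $B(x,r)$ denotes the open ball of radius $r$ centered at $x$, and $(X,\mu,T)$ is a probability measure preserving system ($\mu$ a Borel probability measure, $T:X\to X$ measurable and $\mu$-preserving). Cylinders: there are at most countably many pairwise disjoint open subsets $X_i$, $i\in\mathcal I$, of $X$ such that $T|_{X_i}$ is continuous and injective for each $i$ and $\mu(X\setminus\bigcup_iX_i)=0$. For $m\in\mathbb{N}$, $\mathcal F_m:=\{X_{i_1}\cap T^{-1}X_{i_2}\cap\cdots\cap T^{-(m-1)}X_{i_m}: i_1,\dots,i_m\in\mathcal I\}$ (cylinders of order $m$). For $J\in\mathcal F_m$, $K_J:=\inf_{x,y\in J,\,x\ne y}\frac{d(T^mx,T^my)}{d(x,y)}$ (with $\inf\varnothing=+\infty$). Conditions assumed: - Ahlfors regularity of dimension $\delta>0$: there are $\eta_1,\eta_2,r_0>0$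 with $\eta_1r^\delta\le\mu(B(x,r))\le\eta_2r^\delta$ for every ball $B(x,r)\subset X$ with $0<r<r_0$. - Uniform mixing: there is a summable sequence of positive reals $(a_n)_{n\in\mathbb N}$ with $|\mu(E\cap T^{-n}F)-\mu(E)\mu(F)|\le a_n\mu(F)$ for all balls $E,F\subset X$ and all $n\ge1$. - Bounded distortion: there is $K_1>0$ with $K_1^{-1}\le\frac{d(T^mx,T^my)/d(x,y)}{d(T^mx,T^mz)/d(x,z)}\le K_1$ for all $m\in\mathbb N$ and all $x,y,z\in J\in\mathcal F_m$ with $x\ne y$, $x\ne z$. - Expanding: $\inf_{J\in\mathcal F_m}K_J\to\infty$ as $m\to\infty$, and $\sup_{m\in\mathbb N}\sum_{J\in\mathcal F_m}K_J^{-\delta}<\infty$. - Conformality: there is $K_2\ge1$ with $B(T^mx,K_2^{-1}K_Jr)\subset T^mB(x,r)\subset B(T^mx,K_2K_Jr)$ for any $m\in\mathbb N$ and any ball $B(x,r)\subset J\in\mathcal F_m$. A map $g:X\to X$ is Lipschitz if $\sup_{x\neq y}d(g(x),g(y))/d(x,y)<\infty$. A map $f:X\to X$ is piecewise Lipschitz if there are at most countably many measurable subsets $Y_i$ of $X$ and Lipschitz functions $f_i:X\to X$ with $\mu(X\setminus\bigcup_iY_i)=0$ and $f|_{Y_i}=f_i|_{Y_i}$ for each $i$. *)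

theory Defs
  imports "HOL-Probability.Probability"
begin

text \<open>
  The space is a type of class \<open>metric_space\<close>; its compactness (hence separability) is a
  hypothesis of the theorem. The natural numbers are \<open>1, 2, 3, \<dots>\<close>, so every index of type
  \<^typ>\<open>nat\<close> below is guarded to be positive.
\<close>

definition borel_pmp_system :: "'a::metric_space measure \<Rightarrow> ('a \<Rightarrow> 'a) \<Rightarrow> bool" where
  "borel_pmp_system M T \<longleftrightarrow>
     prob_space M \<and> sets M = sets borel \<and> T \<in> measurable M M \<and> distr M M T = M"

definition cylinder_base ::
    "'a::metric_space measure \<Rightarrow> ('a \<Rightarrow> 'a) \<Rightarrow> 'i set \<Rightarrow> ('i \<Rightarrow> 'a set) \<Rightarrow> bool" where
  "cylinder_base M T I X \<longleftrightarrow>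
     countable I \<and> disjoint_family_on X I \<and>
     (\<forall>i\<in>I. open (X i) \<and> continuous_on (X i) T \<and> inj_on T (X i)) \<and>
     emeasure M (space M - (\<Union>i\<in>I. X i)) = 0"

text \<open>The value \<open>w k\<close> is the letter \<open>i\<^bsub>k+1\<^esub>\<close> of the word \<open>i\<^sub>1 \<dots> i\<^sub>m\<close>.\<close>

definition cylinders ::
    "('a \<Rightarrow> 'a) \<Rightarrow> 'i set \<Rightarrow> ('i \<Rightarrow> 'a set) \<Rightarrow> nat \<Rightarrow> 'a set set" where
  "cylinders T I X m = {(\<Inter>k<m. (T ^^ k) -` X (w k)) | w. \<forall>k<m. w k \<in> I}"

text \<open>
  \<open>K\<^sub>J\<close> takes values in \<^typ>\<open>ennreal\<close>, so that the infimum over the empty set is \<open>\<infinity>\<close>. A set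
  may be a cylinder of several orders, hence the argument \<open>m\<close>.
\<close>

definition expansion :: "('a::metric_space \<Rightarrow> 'a) \<Rightarrow> nat \<Rightarrow> 'a set \<Rightarrow> ennreal" where
  "expansion T m J =
     (INF (x, y) \<in> {(x, y). x \<in> J \<and> y \<in> J \<and> x \<noteq> y}.
        ennreal (dist ((T ^^ m) x) ((T ^^ m) y) / dist x y))"

text \<open>The power \<open>k\<^sup>-\<^sup>\<delta>\<close> for \<open>\<delta> > 0\<close>, with \<open>0\<^sup>-\<^sup>\<delta> = \<infinity>\<close> and \<open>\<infinity>\<^sup>-\<^sup>\<delta> = 0\<close>.\<close>

definition neg_powr :: "ennreal \<Rightarrow> real \<Rightarrow> ennreal" where
  "neg_powr k \<delta> =
     (if k = \<infinity> then 0 else if k = 0 then \<infinity> else ennreal (enn2real k powr (- \<delta>)))"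

text \<open>
  Open ball whose radius is an extended nonnegative real; needed because \<open>K\<^sub>J\<close> enters the
  radii in the conformality condition.
\<close>

definition eball :: "'a::metric_space \<Rightarrow> ennreal \<Rightarrow> 'a set" where
  "eball x R = {y. ennreal (dist x y) < R}"

definition ahlfors_regular :: "'a::metric_space measure \<Rightarrow> real \<Rightarrow> bool" where
  "ahlfors_regular M \<delta> \<longleftrightarrow>
     (\<exists>\<eta>1>0. \<exists>\<eta>2>0. \<exists>r0>0. \<forall>x r. 0 < r \<and> r < r0 \<longrightarrow>
        \<eta>1 * r powr \<delta> \<le> measure M (ball x r) \<and> measure M (ball x r) \<le> \<eta>2 * r powr \<delta>)"

definition uniformly_mixing :: "'a::metric_space measure \<Rightarrow> ('a \<Rightarrow> 'a) \<Rightarrow> bool" where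
  "uniformly_mixing M T \<longleftrightarrow>
     (\<exists>a :: nat \<Rightarrow> real. (\<forall>n\<ge>1. 0 < a n) \<and> summable (\<lambda>n. a (Suc n)) \<and>
        (\<forall>x r y s n. 0 < r \<and> 0 < s \<and> 1 \<le> n \<longrightarrow>
           \<bar>measure M (ball x r \<inter> (T ^^ n) -` ball y s) - measure M (ball x r) * measure M (ball y s)\<bar>
             \<le> a n * measure M (ball y s)))"

definition bounded_distortion ::
    "('a::metric_space \<Rightarrow> 'a) \<Rightarrow> 'i set \<Rightarrow> ('i \<Rightarrow> 'a set) \<Rightarrow> bool" where
  "bounded_distortion T I X \<longleftrightarrow>
     (\<exists>K1>0. \<forall>m\<ge>1. \<forall>J\<in>cylinders T I X m. \<forall>x\<in>J. \<forall>y\<in>J. \<forall>z\<in>J. x \<noteq> y \<and> x \<noteq> z \<longrightarrow>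
        inverse K1 \<le> (dist ((T ^^ m) x) ((T ^^ m) y) / dist x y) /
                      (dist ((T ^^ m) x) ((T ^^ m) z) / dist x z) \<and>
        (dist ((T ^^ m) x) ((T ^^ m) y) / dist x y) /
          (dist ((T ^^ m) x) ((T ^^ m) z) / dist x z) \<le> K1)"

definition expanding ::
    "('a::metric_space \<Rightarrow> 'a) \<Rightarrow> 'i set \<Rightarrow> ('i \<Rightarrow> 'a set) \<Rightarrow> real \<Rightarrow> bool" where
  "expanding T I X \<delta> \<longleftrightarrow>
     ((\<lambda>m. INF J\<in>cylinders T I X m. expansion T m J) \<longlonglongrightarrow> \<infinity>) \<and>
     (SUP m\<in>{1..}. \<Sum>\<^sub>\<infinity>J\<in>cylinders T I X m. neg_powr (expansion T m J) \<delta>) < \<infinity>"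

definition conformal ::
    "('a::metric_space \<Rightarrow> 'a) \<Rightarrow> 'i set \<Rightarrow> ('i \<Rightarrow> 'a set) \<Rightarrow> bool" where
  "conformal T I X \<longleftrightarrow>
     (\<exists>K2\<ge>1. \<forall>m\<ge>1. \<forall>J\<in>cylinders T I X m. \<forall>x r. 0 < r \<and> ball x r \<subseteq> J \<longrightarrow>
        eball ((T ^^ m) x) (ennreal (inverse K2) * expansion T m J * ennreal r)
          \<subseteq> (T ^^ m) ` ball x r \<and>
        (T ^^ m) ` ball x r
          \<subseteq> eball ((T ^^ m) x) (ennreal K2 * expansion T m J * ennreal r))"

definition piecewise_lipschitz :: "'a::metric_space measure \<Rightarrow> ('a \<Rightarrow> 'a) \<Rightarrow> bool" where
  "piecewise_lipschitz M f \<longleftrightarrow>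
     (\<exists>(N :: nat set) (Y :: nat \<Rightarrow> 'a set) (g :: nat \<Rightarrow> 'a \<Rightarrow> 'a).
        (\<forall>i\<in>N. Y i \<in> sets M \<and> (\<exists>L. L-lipschitz_on UNIV (g i)) \<and> (\<forall>x\<in>Y i. f x = g i x)) \<and>
        emeasure M (space M - (\<Union>i\<in>N. Y i)) = 0)"

text \<open>
  A piecewise Lipschitz map is arbitrary on a null set, so the following set need not be Borel;
  its measure is to be taken in the completion of \<open>M\<close>.
\<close>

definition recurrence_set ::
    "('a::metric_space \<Rightarrow> 'a) \<Rightarrow> ('a \<Rightarrow> 'a) \<Rightarrow> (nat \<Rightarrow> real) \<Rightarrow> 'a set" where
  "recurrence_set T f \<psi> = {x. infinite {n. 1 \<le> n \<and> dist ((T ^^ n) x) (f x) < \<psi> n}}"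

end

theory Submission
  imports Defs
begin

text \<open>
  A piecewise Lipschitz map may be replaced by a Lipschitz map \<open>g\<close>. Let \<open>E\<^sub>n\<close> be the set of the
  points \<open>x\<close> with \<open>d(T\<^sup>n x, g x) < \<psi>(n)\<close> and put \<open>p\<^sub>n = \<psi>(n)\<^sup>\<delta>\<close>. As \<open>a\<^sub>n\<close> is summable, the indices
  with \<open>a\<^sub>n > \<epsilon> p\<^sub>n\<close> carry a finite part of the divergent sum \<open>\<Sum> p\<^sub>n\<close> and are dropped; for the
  others, mixing on balls of radius comparable to \<open>\<psi>(n)\<close> gives \<open>\<mu>(U \<inter> E\<^sub>n) \<ge> c \<mu>(U) p\<^sub>n\<close>
  asymptotically for every open \<open>U\<close>. On a cylinder \<open>J\<close> of order \<open>m\<close> the set \<open>E\<^sub>m \<inter> J\<close> has diameter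
  at most \<open>4 \<psi>(m) / K\<^sub>J\<close>, and pulling the second return back through the expanding map \<open>T\<^sup>m\<close> gives
  \<open>\<mu>(E\<^sub>m \<inter> E\<^sub>n) \<le> C (p\<^sub>m p\<^sub>n + a\<^bsub>n-m\<^esub> (p\<^sub>m + p\<^sub>n))\<close>. So the normalised counting functions of the
  \<open>E\<^sub>n\<close> are bounded in \<open>L\<^sup>2\<close> while their mean over every open set is bounded below. If the points that
  lie in only finitely many \<open>E\<^sub>n\<close> had positive measure, then a tight open neighbourhood of a large
  part of them would have to carry this mass on a set of small measure, which the \<open>L\<^sup>2\<close> bound forbids.
\<close>

section \<open>Separated sets and approximation in compact metric spaces\<close>

text \<open>The condition runs over the points outside \<open>U\<close>, so no distance to a
  possibly empty complement is needed and the whole space erodes to itself. Erosions are closed,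
  they exhaust an open set as \<open>h\<close> tends to 0, and balls of radius at most
  \<open>h\<close> about their points stay inside \<open>U\<close>.\<close>

definition erosion :: "'a::metric_space set \<Rightarrow> real \<Rightarrow> 'a set" where
  "erosion U h = {x. \<forall>y. y \<notin> U \<longrightarrow> h \<le> dist x y}"

lemma closed_erosion: "closed (erosion U h)"
proof -
  have "erosion U h = (\<Inter>y\<in>-U. {x. h \<le> dist x y})"
    by (auto simp: erosion_def)
  moreover have "closed {x. h \<le> dist x y}" for y
    by (intro closed_Collect_le continuous_intros)
  ultimately show ?thesis by auto
qed

lemma ball_subset_erosion: "x \<in> erosion U h \<Longrightarrow> r \<le> h \<Longrightarrow> ball x r \<subseteq> U"
  by (force simp: erosion_def)

lemma erosion_antimono: "h \<le> k \<Longrightarrow> erosion U k \<subseteq> erosion U h"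
  by (force simp: erosion_def)

lemma UN_erosion:
  assumes "open U"
  shows "(\<Union>j. erosion U (1 / real (Suc j))) = U"
proof
  show "(\<Union>j. erosion U (1 / real (Suc j))) \<subseteq> U"
  proof
    fix x assume "x \<in> (\<Union>j. erosion U (1 / real (Suc j)))"
    then obtain j where j: "x \<in> erosion U (1 / real (Suc j))" by auto
    show "x \<in> U"
    proof (rule ccontr)
      assume "x \<notin> U"
      with j have "1 / real (Suc j) \<le> dist x x" unfolding erosion_def by blast
      then show False by (auto simp: divide_simps)
    qed
  qed
  show "U \<subseteq> (\<Union>j. erosion U (1 / real (Suc j)))"
  proof
    fix x assume "x \<in> U"
    then obtain e where e: "e > 0" "ball x e \<subseteq> U"
      using assms open_contains_ball by blast
    obtain j where "1 / real (Suc j) < e"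
      using e(1) by (metis nat_approx_posE)
    with e(2) have "x \<in> erosion U (1 / real (Suc j))"
      by (force simp: erosion_def simp del: of_nat_Suc)
    then show "x \<in> (\<Union>j. erosion U (1 / real (Suc j)))" by blast
  qed
qed

lemma incseq_erosion: "incseq (\<lambda>j. erosion U (1 / real (Suc j)))"
  by (intro incseq_SucI erosion_antimono) (auto simp: divide_simps)

text \<open>Regularity of finite Borel measures: the sets admitting such a sandwich contain the
  closed sets and are stable under complements and countable unions, hence include every Borel
  set.\<close>

lemma closed_open_approximation:
  fixes M :: "'a::metric_space measure"
  assumes "finite_measure M" and sets_M: "sets M = sets borel" and "A \<in> sets M" "0 < e"
  shows "\<exists>F U. closed F \<and> open U \<and> F \<subseteq> A \<and> A \<subseteq> U \<and> measure M (U - F) < e"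
proof -
  interpret finite_measure M by fact
  have [simp]: "space M = UNIV"
    using sets_eq_imp_space_eq[OF sets_M] by simp
  have sets_open [simp]: "open U \<Longrightarrow> U \<in> sets M" and sets_closed [simp]: "closed U \<Longrightarrow> U \<in> sets M"
    for U by (simp_all add: sets_M)
  have "A \<in> sigma_sets UNIV {F::'a set. closed F}"
    using assms(3) unfolding sets_M borel_eq_closed by simp
  then show ?thesis using \<open>0 < e\<close>
  proof (induction arbitrary: e rule: sigma_sets.induct)
    case (Basic F)
    then have cl: "closed F" by simp
    \<comment> \<open>\<open>- erosion (- F) h\<close> is the open \<open>h\<close>-neighbourhood of
      \<open>F\<close>; as \<open>F\<close> is closed, these neighbourhoods shrink to
      \<open>F\<close> and the excess \<open>?W j\<close> decreases to the empty set.\<close>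
    let ?W = "\<lambda>j. - erosion (- F) (1 / real (Suc j)) - F"
    have "(\<lambda>j. measure M (?W j)) \<longlonglongrightarrow> measure M (\<Inter>j. ?W j)"
    proof (rule finite_Lim_measure_decseq)
      show "range ?W \<subseteq> sets M"
        using closed_erosion[of "- F"] cl by (auto intro!: sets.Diff sets_open)
      show "decseq ?W"
        using incseq_erosion[of "- F"] by (auto simp: decseq_def incseq_def)
    qed
    moreover have "(\<Inter>j. ?W j) = {}"
      using UN_erosion[of "- F"] cl by auto
    ultimately have "(\<lambda>j. measure M (?W j)) \<longlonglongrightarrow> 0"
      by (simp only: measure_empty)
    then have "eventually (\<lambda>j. measure M (?W j) < e) sequentially"
      using Basic(2) by (auto simp: order_tendsto_iff)
    then obtain j where j: "measure M (?W j) < e"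
      by (auto simp: eventually_sequentially)
    have "F \<subseteq> - erosion (- F) (1 / real (Suc j))"
      using UN_erosion[of "- F"] cl by auto
    moreover have "open (- erosion (- F) (1 / real (Suc j)))"
      using closed_erosion by auto
    ultimately show ?case using j cl by blast
  next
    case Empty
    then show ?case by (intro exI[of _ "{}"]) auto
  next
    case (Compl A)
    obtain F U where FU: "closed F" "open U" "F \<subseteq> A" "A \<subseteq> U" "measure M (U - F) < e"
      using Compl.IH[OF Compl.prems] by (elim exE conjE)
    have "- F - - U = U - F" by blast
    with FU show ?case
      by (intro exI[of _ "- U"] exI[of _ "- F"]) (simp, blast)
  next
    case (Union A)
    \<comment> \<open>The errors are weighted to add up to \<open>e / 2\<close>. The other half pays
      for truncating the union of the closed sets \<open>F i\<close> to a finite one, since the full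
      union need not be closed.\<close>
    have "\<exists>F U. closed F \<and> open U \<and> F \<subseteq> A i \<and> A i \<subseteq> U \<and> measure M (U - F) < (e / 2) * (1/2) ^ Suc i" for i
      using Union.prems by (intro Union.IH) simp
    then obtain F U where cl: "\<And>i. closed (F i)" and op: "\<And>i. open (U i)"
      and FA: "\<And>i. F i \<subseteq> A i" and AU: "\<And>i. A i \<subseteq> U i"
      and small: "\<And>i. measure M (U i - F i) < (e / 2) * (1/2) ^ Suc i"
      by metis
    let ?U = "\<Union>i. U i" and ?F = "\<lambda>n. \<Union>i<n. F i"
    have geo: "(\<lambda>i. (e / 2) * (1/2) ^ Suc i) sums (e / 2)"
      using sums_mult[OF power_half_series, of "e / 2"] by simp
    have meas: "U i - F i \<in> sets M" for i using cl op by auto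
    have summ: "summable (\<lambda>i. measure M (U i - F i))"
      using small by (intro summable_comparison_test[OF _ sums_summable[OF geo]])
        (auto intro: less_imp_le)
    have "measure M (\<Union>i. U i - F i) \<le> (\<Sum>i. measure M (U i - F i))"
      using meas summ by (intro finite_measure_subadditive_countably) auto
    also have "\<dots> \<le> e / 2"
      using suminf_le[OF less_imp_le[OF small] summ sums_summable[OF geo]] sums_unique[OF geo]
      by simp
    finally have *: "measure M (\<Union>i. U i - F i) \<le> e / 2" .
    have "(\<lambda>n. measure M (?U - ?F n)) \<longlonglongrightarrow> measure M (\<Inter>n. ?U - ?F n)"
    proof (rule finite_Lim_measure_decseq)
      show "range (\<lambda>n. ?U - ?F n) \<subseteq> sets M"
        using cl op by (auto intro!: sets.Diff sets.countable_UN)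
      show "decseq (\<lambda>n. ?U - ?F n)"
        by (force simp: decseq_def)
    qed
    moreover have "measure M (\<Inter>n. ?U - ?F n) \<le> measure M (\<Union>i. U i - F i)"
    proof (rule finite_measure_mono)
      show "(\<Inter>n. ?U - ?F n) \<subseteq> (\<Union>i. U i - F i)" by blast
      show "(\<Union>i. U i - F i) \<in> sets M" using meas by blast
    qed
    ultimately have "eventually (\<lambda>n. measure M (?U - ?F n) < e) sequentially"
      using * Union.prems by (auto simp: order_tendsto_iff)
    then obtain n where n: "measure M (?U - ?F n) < e"
      by (auto simp: eventually_sequentially)
    have "closed (?F n)" using cl by auto
    moreover have "open ?U" using op by auto
    moreover have "?F n \<subseteq> (\<Union>i. A i)" "(\<Union>i. A i) \<subseteq> ?U" using FA AU by blast+
    ultimately show ?case using n by blast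
  qed
qed

text \<open>A separated set of maximal cardinality is a net, because an uncovered point could be
  added to it. The cardinality is bounded since a ball of radius \<open>r / 2\<close> contains at
  most one point of an \<open>r\<close>-separated set, and finitely many such balls cover the
  space.\<close>

lemma separated_net_exists:
  fixes S :: "'a::metric_space set"
  assumes "compact (UNIV :: 'a set)" "0 < r"
  obtains C where "finite C" "C \<subseteq> S" "pairwise (\<lambda>x y. r \<le> dist x y) C"
    "S \<subseteq> (\<Union>x\<in>C. ball x r)"
proof -
  obtain K :: "'a set" where K: "finite K" "UNIV \<subseteq> (\<Union>x\<in>K. ball x (r / 2))"
    using seq_compact_imp_totally_bounded[OF compact_imp_seq_compact[OF assms(1)]] assms(2)
    by (metis half_gt_zero)
  define P where "P C \<longleftrightarrow> finite C \<and> C \<subseteq> S \<and> pairwise (\<lambda>x y. r \<le> dist x y) C" for C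
  have bound: "card C \<le> card K" if "P C" for C
  proof -
    have "\<exists>z\<in>K. x \<in> ball z (r / 2)" for x using K(2) by blast
    then obtain \<phi> where \<phi>: "\<And>x. \<phi> x \<in> K" "\<And>x. dist (\<phi> x) x < r / 2"
      by (metis mem_ball)
    have "inj_on \<phi> C"
    proof (rule inj_onI, rule ccontr)
      fix x y assume "x \<in> C" "y \<in> C" "\<phi> x = \<phi> y" "x \<noteq> y"
      with that have "r \<le> dist x y" by (auto simp: P_def pairwise_def)
      also have "\<dots> < r"
        using dist_triangle_half_r[OF \<phi>(2)[of x], of y] \<phi>(2)[of y] \<open>\<phi> x = \<phi> y\<close> by simp
      finally show False by simp
    qed
    then show ?thesis using \<phi>(1) K(1) by (intro card_inj_on_le) auto
  qed
  have "P {}" by (simp add: P_def)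
  obtain C where C: "P C" "\<And>D. P D \<Longrightarrow> card D \<le> card C"
    using ex_has_greatest_nat[of P "{}" card "Suc (card K)"] \<open>P {}\<close> bound
    by (metis less_Suc_eq_le)
  have "S \<subseteq> (\<Union>x\<in>C. ball x r)"
  proof (rule subsetI, rule ccontr)
    fix z assume z: "z \<in> S" "z \<notin> (\<Union>x\<in>C. ball x r)"
    then have "P (insert z C)" using C(1) by (auto simp: P_def pairwise_insert dist_commute not_less)
    moreover have "z \<notin> C" using z assms(2) by auto
    ultimately have "Suc (card C) \<le> card C"
      using C(2)[of "insert z C"] C(1) by (simp add: P_def)
    then show False by simp
  qed
  with C(1) that show thesis by (auto simp: P_def)
qed

lemma disjoint_separated_balls:
  assumes "pairwise (\<lambda>x y. 2 * r \<le> dist x y) C"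
  shows "disjoint_family_on (\<lambda>x. ball x r) C"
  unfolding disjoint_family_on_def
proof (intro ballI impI)
  fix x y assume "x \<in> C" "y \<in> C" "x \<noteq> y"
  then have d: "2 * r \<le> dist x y" using assms by (auto simp: pairwise_def)
  have False if "z \<in> ball x r" "z \<in> ball y r" for z
    using that d dist_triangle2[of x y z] by simp
  then show "ball x r \<inter> ball y r = {}" by blast
qed

lemma countable_dense_if_compact:
  assumes "compact (UNIV :: 'a::metric_space set)"
  obtains Q :: "'a::metric_space set" where "countable Q" "\<forall>x. \<forall>e>0. \<exists>q\<in>Q. dist x q < e"
proof -
  have "\<exists>C::'a set. finite C \<and> (UNIV \<subseteq> (\<Union>x\<in>C. ball x (1 / real (Suc j))))" for j
    using separated_net_exists[OF assms, of "1 / real (Suc j)" UNIV]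
    by (metis of_nat_0_less_iff zero_less_Suc zero_less_divide_1_iff)
  then obtain C :: "nat \<Rightarrow> 'a set" where C: "\<And>j. finite (C j)"
    "\<And>j. UNIV \<subseteq> (\<Union>x\<in>C j. ball x (1 / real (Suc j)))" by metis
  show thesis
  proof (rule that)
    show "countable (\<Union>j. C j)" using C(1) by (auto intro: countable_finite)
    show "\<forall>x. \<forall>e>0. \<exists>q\<in>\<Union>j. C j. dist x q < e"
    proof (intro allI impI)
      fix x :: 'a and e :: real assume "0 < e"
      then obtain j where "1 / real (Suc j) < e" by (metis nat_approx_posE)
      moreover have "x \<in> (\<Union>q\<in>C j. ball q (1 / real (Suc j)))" using C(2)[of j] by blast
      ultimately show "\<exists>q\<in>\<Union>j. C j. dist x q < e"
        by (force simp: dist_commute simp del: of_nat_Suc)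
    qed
  qed
qed

text \<open>With a countable dense set \<open>Q\<close>, the inequality says that some
  \<open>q\<close> in \<open>Q\<close> joins the two points by a path of length below
  \<open>r\<close>. Only distances to fixed points remain, and these are continuous, so the Borel
  structure of the product never enters.\<close>

lemma measurable_dist_less:
  fixes u v :: "'b \<Rightarrow> 'a::metric_space"
  assumes "compact (UNIV :: 'a set)" and [measurable]: "u \<in> borel_measurable N" "v \<in> borel_measurable N"
  shows "{x \<in> space N. dist (u x) (v x) < r} \<in> sets N"
proof -
  obtain Q :: "'a set" where Q: "countable Q" "\<forall>x. \<forall>e>0. \<exists>q\<in>Q. dist x q < e"
    by (rule countable_dense_if_compact[OF assms(1)])
  have [measurable]: "(\<lambda>z. dist z q) \<in> borel_measurable borel" for q :: 'a
    by (intro borel_measurable_continuous_onI continuous_intros)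
  have "dist (u x) (v x) < r \<longleftrightarrow> (\<exists>q\<in>Q. dist (u x) q + dist (v x) q < r)" for x
  proof
    assume "dist (u x) (v x) < r"
    then obtain q where q: "q \<in> Q" "dist (v x) q < (r - dist (u x) (v x)) / 2"
      using Q(2)[rule_format, of "(r - dist (u x) (v x)) / 2" "v x"] by auto
    then have "dist (u x) q + dist (v x) q < r"
      using dist_triangle[of "u x" q "v x"] by (simp add: field_simps)
    with q(1) show "\<exists>q\<in>Q. dist (u x) q + dist (v x) q < r" by blast
  next
    assume "\<exists>q\<in>Q. dist (u x) q + dist (v x) q < r"
    then show "dist (u x) (v x) < r"
      by (metis dist_triangle2 le_less_trans)
  qed
  then have "{x \<in> space N. dist (u x) (v x) < r}
      = (\<Union>q\<in>Q. {x \<in> space N. dist (u x) q + dist (v x) q < r})" by auto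
  also have "\<dots> \<in> sets N"
    using Q(1) by (intro sets.countable_UN'' ) measurable
  finally show ?thesis .
qed

section \<open>Ahlfors regular measures\<close>

locale ahlfors_space = prob_space M for M :: "'a::metric_space measure" +
  fixes \<delta> \<eta>1 \<eta>2 r0 :: real
  assumes compact_UNIV: "compact (UNIV :: 'a set)"
    and sets_M: "sets M = sets borel"
    and \<delta>_pos: "0 < \<delta>" and \<eta>1_pos: "0 < \<eta>1" and \<eta>2_pos: "0 < \<eta>2" and r0_pos: "0 < r0"
    and ball_lower: "\<And>x r. 0 < r \<Longrightarrow> r < r0 \<Longrightarrow> \<eta>1 * r powr \<delta> \<le> measure M (ball x r)"
    and ball_upper: "\<And>x r. 0 < r \<Longrightarrow> r < r0 \<Longrightarrow> measure M (ball x r) \<le> \<eta>2 * r powr \<delta>"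
begin

lemma space_M: "space M = UNIV"
  using sets_eq_imp_space_eq[OF sets_M] by simp

lemma open_in_sets: "open U \<Longrightarrow> U \<in> sets M"
  and closed_in_sets: "closed U \<Longrightarrow> U \<in> sets M"
  by (simp_all add: sets_M)

lemma ball_in_sets: "ball x r \<in> sets M"
  by (rule open_in_sets) simp

lemma vimage_in_sets: "S \<in> measurable M M \<Longrightarrow> A \<in> sets M \<Longrightarrow> S -` A \<in> sets M"
  using measurable_sets[of S M M A] by (simp add: space_M)

lemma measure_le_diameter:
  assumes "A \<in> sets M" "0 < r" "r < r0" "\<And>x y. x \<in> A \<Longrightarrow> y \<in> A \<Longrightarrow> dist x y < r"
  shows "measure M A \<le> \<eta>2 * r powr \<delta>"
proof (cases "A = {}")
  case True
  then show ?thesis using \<eta>2_pos by simp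
next
  case False
  then obtain x where "x \<in> A" by blast
  then have "A \<subseteq> ball x r" using assms(4) by auto
  then have "measure M A \<le> measure M (ball x r)"
    by (intro finite_measure_mono open_in_sets) auto
  also have "\<dots> \<le> \<eta>2 * r powr \<delta>" using assms(2,3) by (rule ball_upper)
  finally show ?thesis .
qed

text \<open>A single point lies in arbitrarily small balls, whose measure tends to 0. This disposes
  of the cylinders with infinite expansion, which have at most one point.\<close>

lemma measure_subsingleton:
  assumes "A \<in> sets M" "\<And>x y. x \<in> A \<Longrightarrow> y \<in> A \<Longrightarrow> x = y"
  shows "measure M A = 0"
proof (rule ccontr)
  assume "measure M A \<noteq> 0"
  then have p: "0 < measure M A" using measure_nonneg[of M A] by linarith
  \<comment> \<open>The radius is chosen so that \<open>\<eta>2 * r powr \<delta>\<close> is at most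
    half of the supposed positive measure.\<close>
  define r where "r = min (r0 / 2) ((measure M A / (2 * \<eta>2)) powr (1 / \<delta>))"
  have r: "0 < r" "r < r0" using p \<eta>2_pos r0_pos by (auto simp: r_def min_def)
  have "r powr \<delta> \<le> ((measure M A / (2 * \<eta>2)) powr (1 / \<delta>)) powr \<delta>"
    using r \<delta>_pos by (intro powr_mono2) (auto simp: r_def)
  also have "\<dots> = measure M A / (2 * \<eta>2)" using p \<delta>_pos \<eta>2_pos by (simp add: powr_powr)
  finally have "\<eta>2 * r powr \<delta> \<le> measure M A / 2" using \<eta>2_pos by (simp add: field_simps)
  moreover have "measure M A \<le> \<eta>2 * r powr \<delta>"
    using r assms by (intro measure_le_diameter) force+
  ultimately show False using p by simp
qed

text \<open>Packing bound: balls of half the separation are disjoint, and each has at least the mass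
  given by the lower regularity bound.\<close>

lemma card_separated_le:
  assumes "finite C" "pairwise (\<lambda>x y. r \<le> dist x y) C" "0 < r" "r < r0"
    and "U \<in> sets M" "(\<Union>x\<in>C. ball x (r / 2)) \<subseteq> U"
  shows "real (card C) * (\<eta>1 * (r / 2) powr \<delta>) \<le> measure M U"
proof -
  have disj: "disjoint_family_on (\<lambda>x. ball x (r / 2)) C"
    using assms(2) by (intro disjoint_separated_balls) simp
  have "real (card C) * (\<eta>1 * (r / 2) powr \<delta>) = (\<Sum>x\<in>C. \<eta>1 * (r / 2) powr \<delta>)" by simp
  also have "\<dots> \<le> (\<Sum>x\<in>C. measure M (ball x (r / 2)))"
    using assms(3,4) by (intro sum_mono ball_lower) auto
  also have "\<dots> = measure M (\<Union>x\<in>C. ball x (r / 2))"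
    using disj by (intro finite_measure_finite_Union[symmetric] assms(1)) (auto intro: open_in_sets)
  also have "\<dots> \<le> measure M U" using assms(5,6) by (intro finite_measure_mono)
  finally show ?thesis .
qed

text \<open>Covering \<open>A\<close> by balls of radius \<open>h\<close> cuts the preimage into
  pieces of diameter below \<open>3 * h / K\<close>, while packing bounds the number of balls by the
  measure of an open set \<open>U\<close> around \<open>A\<close>. The powers of \<open>h\<close>
  cancel, and outer regularity then replaces \<open>U\<close> by \<open>A\<close>.\<close>

lemma measure_expanding_vimage_le:
  assumes S: "S \<in> measurable M M" and J: "J \<in> sets M" and K: "0 < K"
    and expand: "\<And>x y. x \<in> J \<Longrightarrow> y \<in> J \<Longrightarrow> K * dist x y \<le> dist (S x) (S y)"
    and A: "A \<in> sets M"
  shows "measure M (J \<inter> S -` A) \<le> \<eta>2 / \<eta>1 * 6 powr \<delta> * K powr - \<delta> * measure M A"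
proof -
  define c where "c = \<eta>2 / \<eta>1 * 6 powr \<delta> * K powr - \<delta>"
  have c_pos: "0 < c" using \<eta>1_pos \<eta>2_pos K by (simp add: c_def)
  have pre: "J \<inter> S -` B \<in> sets M" if "B \<in> sets M" for B
    using J vimage_in_sets[OF S that] by (rule sets.Int)
  have open_bound: "measure M (J \<inter> S -` A) \<le> c * measure M U" if U: "open U" "A \<subseteq> U" for U
  proof -
    \<comment> \<open>Meeting \<open>A\<close> with an erosion of \<open>U\<close> ensures that the
      half-size balls about the net points stay in \<open>U\<close>, as packing requires. The
      erosions exhaust \<open>U\<close>, so nothing is lost in the limit.\<close>
    let ?A = "\<lambda>j. A \<inter> erosion U (1 / real (Suc j))"
    have A_sets: "?A j \<in> sets M" for j
      using A closed_in_sets[OF closed_erosion] by blast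
    have step: "measure M (J \<inter> S -` ?A j) \<le> c * measure M U"
      if small: "1 / real (Suc j) < min r0 (K * r0 / 3)" for j
    proof -
      define h where "h = 1 / real (Suc j)"
      have "0 < h" by (simp add: h_def)
      moreover have "h < r0" "h < K * r0 / 3" using small unfolding h_def by linarith+
      ultimately have h: "0 < h" "h < r0" "3 * h / K < r0"
        using K by (auto simp: field_simps)
      obtain C where C: "finite C" "C \<subseteq> ?A j" "pairwise (\<lambda>x y. h \<le> dist x y) C"
        "?A j \<subseteq> (\<Union>x\<in>C. ball x h)"
        by (rule separated_net_exists[OF compact_UNIV h(1)])
      have "C \<subseteq> erosion U h" using C(2) by (simp add: h_def)
      then have "ball x (h / 2) \<subseteq> U" if "x \<in> C" for x
        using that h(1) by (intro ball_subset_erosion[of x U h]) auto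
      then have card: "real (card C) * (\<eta>1 * (h / 2) powr \<delta>) \<le> measure M U"
        using U(1) C(1,3) h(1,2) by (intro card_separated_le) (auto intro: open_in_sets)
      have piece: "measure M (J \<inter> S -` ball x h) \<le> \<eta>2 * (3 * h / K) powr \<delta>" for x
      proof (rule measure_le_diameter)
        show "J \<inter> S -` ball x h \<in> sets M"
          by (rule pre[OF ball_in_sets])
        show "0 < 3 * h / K" "3 * h / K < r0" using h K by auto
        fix y z assume "y \<in> J \<inter> S -` ball x h" "z \<in> J \<inter> S -` ball x h"
        then have yz: "y \<in> J" "z \<in> J" "dist x (S y) < h" "dist x (S z) < h" by auto
        have "K * dist y z \<le> dist (S y) (S z)" using expand yz by blast
        also have "\<dots> < 3 * h"
          using dist_triangle3[of "S y" "S z" x] yz(3,4) h(1) by linarith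
        finally show "dist y z < 3 * h / K" using K by (simp add: field_simps)
      qed
      have "measure M (J \<inter> S -` ?A j) \<le> measure M (\<Union>x\<in>C. J \<inter> S -` ball x h)"
      proof (rule finite_measure_mono)
        show "J \<inter> S -` ?A j \<subseteq> (\<Union>x\<in>C. J \<inter> S -` ball x h)" using C(4) by blast
        show "(\<Union>x\<in>C. J \<inter> S -` ball x h) \<in> sets M"
          using C(1) by (intro sets.finite_UN pre ball_in_sets)
      qed
      also have "\<dots> \<le> (\<Sum>x\<in>C. measure M (J \<inter> S -` ball x h))"
        using C(1) by (intro finite_measure_subadditive_finite image_subsetI pre ball_in_sets)
      also have "\<dots> \<le> (\<Sum>x\<in>C. \<eta>2 * (3 * h / K) powr \<delta>)" by (intro sum_mono piece)
      also have "\<dots> = c * (real (card C) * (\<eta>1 * (h / 2) powr \<delta>))"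
      proof -
        \<comment> \<open>The 6 is the ratio of the piece scale \<open>3 * h\<close> to the packing
          radius \<open>h / 2\<close>.\<close>
        have "(6 * (h / 2)) powr \<delta> = 6 powr \<delta> * (h / 2) powr \<delta>"
          using h(1) by (subst powr_mult) auto
        moreover have "(3 * h / K) powr \<delta> = (3 * h) powr \<delta> * K powr - \<delta>"
          using h(1) K by (simp add: powr_divide powr_minus_divide)
        ultimately show ?thesis using \<eta>1_pos by (simp add: c_def)
      qed
      also have "\<dots> \<le> c * measure M U" using card c_pos by simp
      finally show ?thesis .
    qed
    have "(\<lambda>j. measure M (J \<inter> S -` ?A j)) \<longlonglongrightarrow> measure M (\<Union>j. J \<inter> S -` ?A j)"
    proof (rule finite_Lim_measure_incseq)
      show "range (\<lambda>j. J \<inter> S -` ?A j) \<subseteq> sets M"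
        by (intro image_subsetI pre A_sets)
      show "incseq (\<lambda>j. J \<inter> S -` ?A j)"
        using incseq_erosion[of U] unfolding incseq_def by blast
    qed
    moreover have "(\<Union>j. J \<inter> S -` ?A j) = J \<inter> S -` A"
      using UN_erosion[OF U(1)] U(2) by blast
    ultimately have "(\<lambda>j. measure M (J \<inter> S -` ?A j)) \<longlonglongrightarrow> measure M (J \<inter> S -` A)"
      by (simp only:)
    moreover have "eventually (\<lambda>j. 1 / real (Suc j) < min r0 (K * r0 / 3)) sequentially"
    proof -
      have "(\<lambda>j. 1 / real (Suc j)) \<longlonglongrightarrow> 0"
        using LIMSEQ_inverse_real_of_nat by (simp add: inverse_eq_divide)
      then show ?thesis using r0_pos K by (intro order_tendstoD) auto
    qed
    then have "eventually (\<lambda>j. measure M (J \<inter> S -` ?A j) \<le> c * measure M U) sequentially"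
      by (rule eventually_mono) (rule step)
    ultimately show ?thesis
      by (intro tendsto_upperbound) auto
  qed
  have "measure M (J \<inter> S -` A) \<le> c * measure M A + e" if "0 < e" for e
  proof -
    obtain F U where FU: "closed F" "open U" "F \<subseteq> A" "A \<subseteq> U" "measure M (U - F) < e / c"
      using closed_open_approximation[OF finite_measure_axioms sets_M A, of "e / c"] \<open>0 < e\<close> c_pos
      by auto
    have diff: "U - F \<in> sets M" using FU by (intro sets.Diff open_in_sets closed_in_sets)
    have "measure M U \<le> measure M (A \<union> (U - F))"
      using FU A diff by (intro finite_measure_mono) auto
    also have "\<dots> \<le> measure M A + measure M (U - F)"
      using A diff by (rule measure_Un_le)
    finally have "measure M U \<le> measure M A + measure M (U - F)" .
    then have "c * measure M U \<le> c * (measure M A + e / c)"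
      using FU(5) c_pos by (intro mult_left_mono) auto
    also have "\<dots> = c * measure M A + e" using c_pos by (simp add: field_simps)
    finally show ?thesis using open_bound[OF FU(2,4)] by linarith
  qed
  then show ?thesis unfolding c_def by (rule field_le_epsilon)
qed

end

section \<open>A Borel--Cantelli lemma\<close>

text \<open>\<open>max m n - min m n\<close> is the distance of \<open>m\<close> and
  \<open>n\<close>. Each distance occurs for at most one \<open>n\<close> on either side of
  \<open>m\<close>, whence the factor 2.\<close>

lemma sum_distance_weights_le:
  fixes a :: "nat \<Rightarrow> real"
  assumes a: "\<And>n. 0 \<le> a n" "summable a" and F: "finite F"
  shows "(\<Sum>n\<in>F. a (max m n - min m n)) \<le> 2 * suminf a"
proof -
  have part: "(\<Sum>n\<in>F'. a (g n)) \<le> suminf a" if "finite F'" "inj_on g F'" for F' :: "nat set" and g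
  proof -
    have "(\<Sum>n\<in>F'. a (g n)) = sum a (g ` F')" using that by (simp add: sum.reindex)
    also have "\<dots> \<le> suminf a" using a that by (intro sum_le_suminf) auto
    finally show ?thesis .
  qed
  have "(\<Sum>n\<in>F. a (max m n - min m n))
      = (\<Sum>n\<in>{n\<in>F. n \<le> m}. a (max m n - min m n)) + (\<Sum>n\<in>{n\<in>F. m < n}. a (max m n - min m n))"
    using F by (subst sum.union_disjoint[symmetric]) (auto intro!: sum.cong)
  also have "\<dots> \<le> suminf a + suminf a"
    using F by (intro add_mono part) (auto simp: inj_on_def)
  finally show ?thesis by simp
qed

lemma unbounded_tail_sum:
  fixes p :: "nat \<Rightarrow> real"
  assumes p: "\<And>n. 0 \<le> p n" and div: "\<not> summable (\<lambda>n. if n \<in> G then p n else 0)"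
  shows "\<exists>F. finite F \<and> F \<subseteq> {n\<in>G. k \<le> n} \<and> B \<le> sum p F"
proof (rule ccontr)
  assume no: "\<nexists>F. finite F \<and> F \<subseteq> {n\<in>G. k \<le> n} \<and> B \<le> sum p F"
  define q where "q n = (if n \<in> G then p n else 0)" for n
  have q: "0 \<le> q n" for n using p by (simp add: q_def)
  have "sum q {..<N} \<le> sum q {..<k} + B" for N
  proof -
    have "sum q {..<N} \<le> sum q ({..<k} \<union> {n\<in>{..<N}. k \<le> n})"
      using q by (intro sum_mono2) auto
    also have "\<dots> = sum q {..<k} + sum q {n\<in>{..<N}. k \<le> n}"
      by (intro sum.union_disjoint) auto
    also have "sum q {n\<in>{..<N}. k \<le> n} = sum p {n\<in>{..<N}. n \<in> G \<and> k \<le> n}"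
      unfolding q_def by (intro sum.mono_neutral_cong_right) auto
    also have "\<dots> \<le> B"
    proof -
      have "finite {n\<in>{..<N}. n \<in> G \<and> k \<le> n}" "{n\<in>{..<N}. n \<in> G \<and> k \<le> n} \<subseteq> {n\<in>G. k \<le> n}"
        by auto
      then have "\<not> B \<le> sum p {n\<in>{..<N}. n \<in> G \<and> k \<le> n}" using no by blast
      then show ?thesis by simp
    qed
    finally show ?thesis by simp
  qed
  then have "summable q" using q by (intro summableI_nonneg_bounded) auto
  with div show False by (simp add: q_def[abs_def])
qed

text \<open>With \<open>z\<close> the number of \<open>E n\<close> containing a point, the pointwise
  bound \<open>z \<le> t + z * z / t\<close> is integrated over \<open>V\<close>. It serves as a
  Cauchy-Schwarz inequality with a free parameter: a counting function with controlled second moment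
  has little mass on a small set.\<close>

lemma (in prob_space) sum_measure_Int_le:
  assumes F: "finite F" and E: "\<And>n. n \<in> F \<Longrightarrow> E n \<in> sets M" and V: "V \<in> sets M" and t: "0 < t"
  shows "(\<Sum>n\<in>F. measure M (V \<inter> E n))
    \<le> t * measure M V + (\<Sum>m\<in>F. \<Sum>n\<in>F. measure M (E m \<inter> E n)) / t"
proof -
  have int: "integrable M (indicat_real A)" if "A \<in> sets M" for A
    using that by (simp add: emeasure_eq_measure)
  have le: "(\<Sum>n\<in>F. indicat_real (V \<inter> E n) x)
      \<le> t * indicat_real V x + (\<Sum>m\<in>F. \<Sum>n\<in>F. indicat_real (E m \<inter> E n) x) / t" for x
  proof -
    define z where "z = (\<Sum>n\<in>F. indicat_real (E n) x)"
    have z2: "(\<Sum>m\<in>F. \<Sum>n\<in>F. indicat_real (E m \<inter> E n) x) = z * z"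
      unfolding z_def by (simp add: sum_product indicator_inter_arith)
    have z1: "(\<Sum>n\<in>F. indicat_real (V \<inter> E n) x) = indicat_real V x * z"
      unfolding z_def by (simp add: sum_distrib_left indicator_inter_arith)
    have "0 \<le> z" unfolding z_def by (intro sum_nonneg) auto
    have "z \<le> t + z * z / t"
    proof (cases "z \<le> t")
      case False
      then have "z * t \<le> z * z" using \<open>0 \<le> z\<close> by (intro mult_left_mono) auto
      then have "z \<le> z * z / t" using t by (simp add: field_simps)
      then show ?thesis using t by simp
    qed (use t \<open>0 \<le> z\<close> in \<open>simp add: add_increasing2\<close>)
    then show ?thesis unfolding z1 z2 using t by (auto simp: indicator_def)
  qed
  have "(\<Sum>n\<in>F. measure M (V \<inter> E n)) = (\<integral>x. (\<Sum>n\<in>F. indicat_real (V \<inter> E n) x) \<partial>M)"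
    using E V by (subst Bochner_Integration.integral_sum) (auto intro!: int)
  also have "\<dots> \<le> (\<integral>x. t * indicat_real V x + (\<Sum>m\<in>F. \<Sum>n\<in>F. indicat_real (E m \<inter> E n) x) / t \<partial>M)"
    using E V le
    by (intro integral_mono Bochner_Integration.integrable_sum Bochner_Integration.integrable_add
        integrable_mult_right integrable_divide int) auto
  also have "\<dots> = (\<integral>x. t * indicat_real V x \<partial>M) +
      (\<integral>x. (\<Sum>m\<in>F. \<Sum>n\<in>F. indicat_real (E m \<inter> E n) x) / t \<partial>M)"
    using E V
    by (intro Bochner_Integration.integral_add Bochner_Integration.integrable_sum
        integrable_mult_right integrable_divide int) auto
  also have "(\<integral>x. (\<Sum>m\<in>F. \<Sum>n\<in>F. indicat_real (E m \<inter> E n) x) / t \<partial>M)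
      = (\<Sum>m\<in>F. \<Sum>n\<in>F. (\<integral>x. indicat_real (E m \<inter> E n) x \<partial>M)) / t"
    using E
    by (simp add: Bochner_Integration.integral_sum Bochner_Integration.integrable_sum int sets.Int)
  finally show ?thesis using E V by (simp add: sets.Int)
qed

text \<open>Suppose the set \<open>D k\<close> of points missing every \<open>E n\<close> with
  \<open>n\<close> in \<open>G\<close> and \<open>k \<le> n\<close> has measure
  \<open>d > 0\<close>. For an open \<open>U\<close> around \<open>D k\<close>, late events have
  total mass at least \<open>c * (d / 2)\<close> times the sum of the \<open>p n\<close> in
  \<open>U\<close>, yet all of it lies in \<open>U - D k\<close>, which can be made too small to
  hold it.\<close>

lemma AE_infinitely_often_if_quasi_independent:
  fixes M :: "'a::metric_space measure" and E :: "nat \<Rightarrow> 'a set" and a p :: "nat \<Rightarrow> real"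
  assumes "prob_space M" and sets_M: "sets M = sets borel"
    and E: "\<And>n. E n \<in> sets M"
    and p: "\<And>n. 0 \<le> p n" and a: "\<And>n. 0 \<le> a n" "summable a"
    and div: "\<not> summable (\<lambda>n. if n \<in> G then p n else 0)"
    and "0 < c" "0 < C"
    and lower: "\<And>U t. open U \<Longrightarrow> 0 < t \<Longrightarrow> t < measure M U \<Longrightarrow>
      \<exists>k. \<forall>n\<in>G. k \<le> n \<longrightarrow> c * t * p n \<le> measure M (U \<inter> E n)"
    and upper: "\<And>n. n \<in> G \<Longrightarrow> measure M (E n) \<le> C * p n"
    and pair: "\<And>m n. m \<in> G \<Longrightarrow> n \<in> G \<Longrightarrow> m < n \<Longrightarrow>
      measure M (E m \<inter> E n) \<le> C * (p m * p n + a (n - m) * (p m + p n))"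
  shows "AE x in M. infinite {n\<in>G. x \<in> E n}"
proof -
  interpret prob_space M by fact
  have space_M: "space M = UNIV" using sets_eq_imp_space_eq[OF sets_M] by simp
  define D where "D k = {x. \<forall>n\<in>G. k \<le> n \<longrightarrow> x \<notin> E n}" for k
  have D_eq: "D k = UNIV - (\<Union>n\<in>{n\<in>G. k \<le> n}. E n)" for k by (auto simp: D_def)
  have D_sets: "D k \<in> sets M" for k
    unfolding D_eq using E sets.top[of M] by (auto simp: space_M)
  \<comment> \<open>One bound for all ordered pairs: the pair estimate is symmetrized, and the last
    summand covers the diagonal. The term with \<open>a 0\<close> arising there is nonnegative and
    only enlarges the bound.\<close>
  have pair': "measure M (E m \<inter> E n) \<le> C * (p m * p n + a (max m n - min m n) * (p m + p n)) +
      (if n = m then C * p m else 0)" if mn: "m \<in> G" "n \<in> G" for m n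
  proof (cases m n rule: linorder_cases)
    case less
    then show ?thesis using pair[OF mn] by simp
  next
    case equal
    have "0 \<le> C * (p m * p m + a 0 * (p m + p m))" using \<open>0 < C\<close> p a by simp
    then show ?thesis using equal upper[OF mn(1)] by simp
  next
    case greater
    then show ?thesis using pair[OF mn(2,1)] by (simp add: Int_commute algebra_simps)
  qed
  define A where "A = suminf a"
  have "0 \<le> A" using a by (simp add: A_def suminf_nonneg)
  \<comment> \<open>Each of the two families of mixing errors, with weights \<open>p m\<close> and
    \<open>p n\<close>, sums to at most \<open>2 * A * sum p F\<close>; together with the diagonal
    this gives \<open>4 * A + 1\<close>.\<close>
  have second: "(\<Sum>m\<in>F. \<Sum>n\<in>F. measure M (E m \<inter> E n)) \<le> C * (sum p F * sum p F + (4 * A + 1) * sum p F)"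
    if F: "finite F" "F \<subseteq> G" for F
  proof -
    let ?a = "\<lambda>m n. a (max m n - min m n)"
    have row: "(\<Sum>m\<in>F. \<Sum>n\<in>F. ?a m n * p m) \<le> 2 * A * sum p F"
    proof -
      have "(\<Sum>m\<in>F. \<Sum>n\<in>F. ?a m n * p m) = (\<Sum>m\<in>F. (\<Sum>n\<in>F. ?a m n) * p m)"
        by (simp add: sum_distrib_right)
      also have "\<dots> \<le> (\<Sum>m\<in>F. (2 * A) * p m)"
        unfolding A_def using a p F by (intro sum_mono mult_right_mono sum_distance_weights_le) auto
      finally show ?thesis by (simp add: sum_distrib_left)
    qed
    have col: "(\<Sum>m\<in>F. \<Sum>n\<in>F. ?a m n * p n) = (\<Sum>m\<in>F. \<Sum>n\<in>F. ?a m n * p m)"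
      by (subst sum.swap) (simp add: max.commute min.commute)
    have "(\<Sum>m\<in>F. \<Sum>n\<in>F. measure M (E m \<inter> E n))
        \<le> (\<Sum>m\<in>F. \<Sum>n\<in>F. C * (p m * p n + ?a m n * (p m + p n)) + (if n = m then C * p m else 0))"
      using F by (intro sum_mono pair') auto
    also have "\<dots> = C * ((\<Sum>m\<in>F. \<Sum>n\<in>F. p m * p n) + ((\<Sum>m\<in>F. \<Sum>n\<in>F. ?a m n * p m) +
        (\<Sum>m\<in>F. \<Sum>n\<in>F. ?a m n * p n))) + C * sum p F"
      using F by (simp add: sum.distrib distrib_left sum_distrib_left)
    also have "\<dots> \<le> C * (sum p F * sum p F + (2 * A * sum p F + 2 * A * sum p F)) + C * sum p F"
      unfolding col using row \<open>0 < C\<close>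
      by (intro add_mono mult_left_mono) (auto simp: sum_product)
    finally show ?thesis by (simp add: algebra_simps)
  qed
  have "measure M (D k) = 0" for k
  proof (rule ccontr)
    define d where "d = measure M (D k)"
    assume "measure M (D k) \<noteq> 0"
    then have d: "0 < d" using measure_nonneg[of M "D k"] unfolding d_def by linarith
    \<comment> \<open>With \<open>t = s * S\<close>, where \<open>S\<close> is the sum of
      \<open>p\<close> over \<open>F\<close>, the second-moment term becomes
      \<open>(c * d / 4) * S\<close>. The bound \<open>c * d / (4 * s)\<close> on the measure of
      \<open>U - K\<close> makes the other term strictly smaller than the same amount, so the sum
      falls below \<open>c * (d / 2) * S\<close>.\<close>
    define s where "s = 8 * C / (c * d)"
    have s: "0 < s" using \<open>0 < C\<close> \<open>0 < c\<close> d by (simp add: s_def)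
    obtain K U where U: "closed K" "open U" "K \<subseteq> D k" "D k \<subseteq> U"
      "measure M (U - K) < c * d / (4 * s)"
      using closed_open_approximation[OF finite_measure_axioms sets_M D_sets[of k], of "c * d / (4 * s)"]
        \<open>0 < c\<close> d s by auto
    have U_sets: "U \<in> sets M" "K \<in> sets M" using U by (auto simp: sets_M)
    let ?V = "U - D k"
    have V_small: "measure M ?V < c * d / (4 * s)"
    proof -
      have "measure M ?V \<le> measure M (U - K)"
        using U U_sets by (intro finite_measure_mono) auto
      then show ?thesis using U(5) by linarith
    qed
    have "d \<le> measure M U" unfolding d_def using U U_sets by (intro finite_measure_mono)
    then obtain k' where k': "\<And>n. n \<in> G \<Longrightarrow> k' \<le> n \<Longrightarrow> c * (d / 2) * p n \<le> measure M (U \<inter> E n)"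
      using lower[OF U(2), of "d / 2"] d by auto
    \<comment> \<open>A sum of at least \<open>4 * A + 1\<close> lets the square absorb the linear
      part of the second-moment bound.\<close>
    obtain F where F: "finite F" "F \<subseteq> {n\<in>G. max k k' \<le> n}" "4 * A + 1 \<le> sum p F"
      using unbounded_tail_sum[OF p div, of "max k k'" "4 * A + 1"] by (elim exE conjE)
    define S where "S = sum p F"
    have S: "0 < S" "4 * A + 1 \<le> S" using F(3) \<open>0 \<le> A\<close> by (auto simp: S_def)
    have "c * (d / 2) * S = (\<Sum>n\<in>F. c * (d / 2) * p n)" by (simp add: S_def sum_distrib_left)
    also have "\<dots> \<le> (\<Sum>n\<in>F. measure M (U \<inter> E n))" using F(2) k' by (intro sum_mono) auto
    \<comment> \<open>Indices in \<open>F\<close> are at least \<open>k\<close>, so their events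
      avoid \<open>D k\<close> by definition.\<close>
    also have "\<dots> = (\<Sum>n\<in>F. measure M (?V \<inter> E n))"
      using F(2) by (intro sum.cong arg_cong[where f = "measure M"]) (auto simp: D_def)
    also have "\<dots> \<le> s * S * measure M ?V + (\<Sum>m\<in>F. \<Sum>n\<in>F. measure M (E m \<inter> E n)) / (s * S)"
      using F(1) E U_sets D_sets s S by (intro sum_measure_Int_le) auto
    also have "\<dots> \<le> s * S * measure M ?V + C * (S * S + S * S) / (s * S)"
    proof -
      have "C * (S * S + (4 * A + 1) * S) \<le> C * (S * S + S * S)"
        using S \<open>0 < C\<close> by (intro mult_left_mono add_left_mono mult_right_mono) auto
      then have "(\<Sum>m\<in>F. \<Sum>n\<in>F. measure M (E m \<inter> E n)) \<le> C * (S * S + S * S)"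
        using second[of F] F unfolding S_def by force
      then show ?thesis using s S by (intro add_left_mono divide_right_mono) auto
    qed
    also have "C * (S * S + S * S) / (s * S) = (c * d / 4) * S"
      using S(1) \<open>0 < C\<close> \<open>0 < c\<close> d by (simp add: s_def field_simps)
    also have "s * S * measure M ?V < s * S * (c * d / (4 * s))"
      using V_small s S by (intro mult_strict_left_mono) auto
    also have "s * S * (c * d / (4 * s)) = (c * d / 4) * S" using s by (simp add: field_simps)
    finally show False by (simp add: field_simps)
  qed
  then have "AE x in M. x \<notin> D k" for k
    using D_sets[of k] by (intro AE_not_in) (auto simp: null_sets_def emeasure_eq_measure)
  then have "AE x in M. \<forall>k. x \<notin> D k" by (simp add: AE_all_countable)
  then show ?thesis
    by (rule AE_mp) (auto intro!: AE_I2 simp: D_def infinite_nat_iff_unbounded_le)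
qed

section \<open>Returns of mixing expanding maps\<close>

text \<open>Countable subadditivity for a sum indexed by the sets themselves. The finite stages are
  summed over the image of \<open>{..<n}\<close> under the enumeration, so repeated sets count once.
  An empty cover is treated apart, since it has no enumeration; it forces \<open>E\<close> to be
  null.\<close>

lemma emeasure_le_sum_over_cover:
  assumes "countable \<F>" "\<F> \<subseteq> sets M" and cover: "AE x in M. x \<in> \<Union>\<F>" and E: "E \<in> sets M"
    and le: "\<And>J. J \<in> \<F> \<Longrightarrow> emeasure M (J \<inter> E) \<le> c * w J"
  shows "emeasure M E \<le> c * (\<Sum>\<^sub>\<infinity>J\<in>\<F>. w J)"
proof (cases "\<F> = {}")
  case True
  with cover have "emeasure M E = emeasure M {}"
    by (intro emeasure_eq_AE E) auto
  then show ?thesis by simp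
next
  case False
  define J where "J i = from_nat_into \<F> i" for i
  have J: "J i \<in> \<F>" for i using False by (simp add: J_def from_nat_into)
  have UJ: "(\<Union>i. J i) = \<Union>\<F>"
    using range_from_nat_into[OF False assms(1)] by (simp add: J_def)
  have J_sets: "J i \<inter> E \<in> sets M" for i using J assms(2) E by blast
  have part_sets: "(\<Union>i<n. J i \<inter> E) \<in> sets M" for n
    by (intro sets.finite_UN J_sets finite_lessThan)
  have part: "emeasure M (\<Union>i<n. J i \<inter> E) \<le> c * (\<Sum>\<^sub>\<infinity>J\<in>\<F>. w J)" for n
  proof -
    have "(\<Union>i<n. J i \<inter> E) = (\<Union>A\<in>J ` {..<n}. A \<inter> E)" by auto
    then have "emeasure M (\<Union>i<n. J i \<inter> E) = emeasure M (\<Union>A\<in>J ` {..<n}. A \<inter> E)" by simp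
    also have "\<dots> \<le> (\<Sum>A\<in>J ` {..<n}. emeasure M (A \<inter> E))"
      using J_sets by (intro emeasure_subadditive_finite) auto
    also have "\<dots> \<le> (\<Sum>A\<in>J ` {..<n}. c * w A)" using J le by (intro sum_mono) auto
    also have "\<dots> = c * (\<Sum>A\<in>J ` {..<n}. w A)" by (simp add: sum_distrib_left)
    also have "(\<Sum>A\<in>J ` {..<n}. w A) \<le> (\<Sum>\<^sub>\<infinity>J\<in>\<F>. w J)"
    proof -
      have "J ` {..<n} \<in> {F. finite F \<and> F \<subseteq> \<F>}" using J by auto
      then show ?thesis by (subst nonneg_infsum_complete) (auto intro: SUP_upper)
    qed
    finally show ?thesis by (simp add: mult_left_mono)
  qed
  have "(\<lambda>n. emeasure M (\<Union>i<n. J i \<inter> E)) \<longlonglongrightarrow> emeasure M (\<Union>n. \<Union>i<n. J i \<inter> E)"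
  proof (rule Lim_emeasure_incseq)
    show "range (\<lambda>n. \<Union>i<n. J i \<inter> E) \<subseteq> sets M" by (intro image_subsetI part_sets)
    show "incseq (\<lambda>n. \<Union>i<n. J i \<inter> E)" unfolding incseq_def by fastforce
  qed
  then have "emeasure M (\<Union>n. \<Union>i<n. J i \<inter> E) \<le> c * (\<Sum>\<^sub>\<infinity>J\<in>\<F>. w J)"
    using part by (intro LIMSEQ_le_const2) auto
  also have "emeasure M (\<Union>n. \<Union>i<n. J i \<inter> E) = emeasure M E"
  proof (rule emeasure_eq_AE)
    have eq: "(\<Union>n. \<Union>i<n. J i \<inter> E) = \<Union>\<F> \<inter> E" unfolding UJ[symmetric] by auto
    show "AE x in M. x \<in> (\<Union>n. \<Union>i<n. J i \<inter> E) \<longleftrightarrow> x \<in> E"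
      unfolding eq using cover by eventually_elim simp
    show "(\<Union>n. \<Union>i<n. J i \<inter> E) \<in> sets M"
      by (intro sets.countable_nat_UN image_subsetI part_sets)
  qed fact
  finally show ?thesis .
qed

text \<open>Words are functions on all of \<open>nat\<close>, but only the first \<open>m\<close>
  letters matter; restricting to \<open>{..<m}\<close> turns the index set into a countable finite
  product.\<close>

lemma countable_cylinders:
  assumes "countable I"
  shows "countable (cylinders T I X m)"
proof -
  have "cylinders T I X m \<subseteq> (\<lambda>w. \<Inter>k<m. (T ^^ k) -` X (w k)) ` (PiE {..<m} (\<lambda>_. I))"
  proof
    fix J assume "J \<in> cylinders T I X m"
    then obtain w where w: "J = (\<Inter>k<m. (T ^^ k) -` X (w k))" "\<forall>k<m. w k \<in> I"
      by (auto simp: cylinders_def)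
    then have "J = (\<Inter>k<m. (T ^^ k) -` X (restrict w {..<m} k))" by auto
    moreover have "restrict w {..<m} \<in> PiE {..<m} (\<lambda>_. I)" using w(2) by auto
    ultimately show "J \<in> (\<lambda>w. \<Inter>k<m. (T ^^ k) -` X (w k)) ` (PiE {..<m} (\<lambda>_. I))" by (rule image_eqI)
  qed
  moreover have "countable (PiE {..<m} (\<lambda>_. I))" using assms by (intro countable_PiE) auto
  ultimately show ?thesis by (meson countable_image countable_subset)
qed

lemma expansion_le:
  assumes "x \<in> J" "y \<in> J" "x \<noteq> y"
  shows "expansion T m J \<le> ennreal (dist ((T ^^ m) x) ((T ^^ m) y) / dist x y)"
  unfolding expansion_def using assms by (intro INF_lower2[of "(x, y)"]) auto

lemma expansion_infinite_subsingleton: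
  assumes "expansion T m J = \<infinity>" "x \<in> J" "y \<in> J"
  shows "x = y"
proof (rule ccontr)
  assume "x \<noteq> y"
  then have "expansion T m J \<le> ennreal (dist ((T ^^ m) x) ((T ^^ m) y) / dist x y)"
    using assms by (intro expansion_le)
  then show False using assms(1) by (simp add: top_unique)
qed

lemma expansion_finite_le:
  assumes "expansion T m J \<noteq> \<infinity>" "x \<in> J" "y \<in> J"
  shows "enn2real (expansion T m J) * dist x y \<le> dist ((T ^^ m) x) ((T ^^ m) y)"
proof (cases "x = y")
  case False
  then have "expansion T m J \<le> ennreal (dist ((T ^^ m) x) ((T ^^ m) y) / dist x y)"
    using assms by (intro expansion_le)
  then have "enn2real (expansion T m J) \<le> dist ((T ^^ m) x) ((T ^^ m) y) / dist x y"
    by (intro enn2real_leI) auto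
  then show ?thesis using False by (simp add: field_simps)
qed auto

section \<open>Return events under mixing and their lower bounds\<close>

locale mixing_system = ahlfors_space M \<delta> \<eta>1 \<eta>2 r0
  for M :: "'a::metric_space measure" and \<delta> \<eta>1 \<eta>2 r0 :: real +
  fixes T :: "'a \<Rightarrow> 'a" and a :: "nat \<Rightarrow> real"
  assumes T_meas [measurable]: "T \<in> measurable M M"
    and a_nonneg: "\<And>n. 0 \<le> a n" and a_summable: "summable a"
    and mixing: "\<And>x r y s n. 0 < r \<Longrightarrow> 0 < s \<Longrightarrow> 1 \<le> n \<Longrightarrow>
      \<bar>measure M (ball x r \<inter> (T ^^ n) -` ball y s) - measure M (ball x r) * measure M (ball y s)\<bar>
        \<le> a n * measure M (ball y s)"
begin

lemma funpow_meas [measurable]: "T ^^ n \<in> measurable M M"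
  by (rule measurable_compose_n) (rule T_meas)

definition return_event :: "('a \<Rightarrow> 'a) \<Rightarrow> real \<Rightarrow> nat \<Rightarrow> 'a set" where
  "return_event g r n = {x. dist ((T ^^ n) x) (g x) < r}"

lemma return_event_sets:
  assumes "L-lipschitz_on UNIV g"
  shows "return_event g r n \<in> sets M"
proof -
  have "g \<in> borel_measurable borel"
    using assms by (intro borel_measurable_continuous_onI lipschitz_on_continuous_on)
  then have [measurable]: "g \<in> borel_measurable M" by (simp add: sets_M cong: measurable_cong_sets)
  have [measurable]: "T ^^ n \<in> borel_measurable M"
    using funpow_meas[of n] by (simp add: sets_M cong: measurable_cong_sets)
  have "{x \<in> space M. dist ((T ^^ n) x) (g x) < r} \<in> sets M"
    by (intro measurable_dist_less compact_UNIV) measurable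
  then show ?thesis by (simp add: return_event_def space_M)
qed

text \<open>On a ball of radius \<open>\<rho>\<close> about \<open>z\<close> the values of
  \<open>g\<close> stay within \<open>L * \<rho>\<close> of \<open>g z\<close>, so a visit to the
  ball of that radius about \<open>g z\<close> is a return within \<open>2 * L * \<rho>\<close>.
  Mixing bounds the measure of these visits from below; the hypothesis on \<open>a n\<close> keeps
  its error below half of the lower bound for the first ball.\<close>

lemma return_event_lower:
  assumes g: "L-lipschitz_on UNIV g" "0 < L" and "1 \<le> n" and U: "open U"
    and \<rho>: "0 < \<rho>" "2 * \<rho> < r0" "L * \<rho> < r0" "\<rho> \<le> h" and a: "a n \<le> \<eta>1 / 2 * \<rho> powr \<delta>"
  shows "\<eta>1\<^sup>2 * L powr \<delta> / (2 * \<eta>2 * 2 powr \<delta>) * measure M (erosion U h) * \<rho> powr \<delta>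
    \<le> measure M (U \<inter> return_event g (2 * L * \<rho>) n)"
proof -
  let ?E = "return_event g (2 * L * \<rho>) n"
  have E: "?E \<in> sets M" by (rule return_event_sets[OF g(1)])
  \<comment> \<open>Separation \<open>2 * \<rho>\<close> makes the balls of radius
    \<open>\<rho>\<close> disjoint, while the doubled balls cover the erosion and so force the net
    to have many points.\<close>
  obtain C where C: "finite C" "C \<subseteq> erosion U h" "pairwise (\<lambda>x y. 2 * \<rho> \<le> dist x y) C"
    "erosion U h \<subseteq> (\<Union>x\<in>C. ball x (2 * \<rho>))"
    by (rule separated_net_exists[OF compact_UNIV, of "2 * \<rho>" "erosion U h"]) (use \<rho> in auto)
  have "measure M (erosion U h) \<le> measure M (\<Union>x\<in>C. ball x (2 * \<rho>))"
    using C by (intro finite_measure_mono open_in_sets) auto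
  also have "\<dots> \<le> (\<Sum>x\<in>C. measure M (ball x (2 * \<rho>)))"
    using C by (intro finite_measure_subadditive_finite) (auto intro: open_in_sets)
  also have "\<dots> \<le> (\<Sum>x\<in>C. \<eta>2 * (2 * \<rho>) powr \<delta>)"
    using \<rho> by (intro sum_mono ball_upper) auto
  finally have net: "measure M (erosion U h) \<le> card C * (\<eta>2 * (2 powr \<delta> * \<rho> powr \<delta>))"
    using \<rho> by (simp add: powr_mult)
  have piece: "(\<eta>1 / 2 * \<rho> powr \<delta>) * (\<eta>1 * (L * \<rho>) powr \<delta>) \<le> measure M (ball z \<rho> \<inter> ?E)" for z
  proof -
    let ?B = "ball z \<rho>" and ?D = "ball (g z) (L * \<rho>)"
    have "?B \<inter> (T ^^ n) -` ?D \<subseteq> ?B \<inter> ?E"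
    proof
      fix x assume x: "x \<in> ?B \<inter> (T ^^ n) -` ?D"
      have "dist (g z) (g x) \<le> L * dist z x" using lipschitz_onD[OF g(1)] by simp
      also have "\<dots> \<le> L * \<rho>" using x g(2) by (intro mult_left_mono) auto
      finally have "dist ((T ^^ n) x) (g x) < 2 * L * \<rho>"
        using x dist_triangle3[of "(T ^^ n) x" "g x" "g z"] by simp
      with x show "x \<in> ?B \<inter> ?E" by (simp add: return_event_def)
    qed
    then have "measure M (?B \<inter> (T ^^ n) -` ?D) \<le> measure M (?B \<inter> ?E)"
      using E by (intro finite_measure_mono sets.Int ball_in_sets)
    moreover have "measure M ?B * measure M ?D - a n * measure M ?D
        \<le> measure M (?B \<inter> (T ^^ n) -` ?D)"
      using mixing[of \<rho> "L * \<rho>" n z "g z"] \<rho> g(2) \<open>1 \<le> n\<close> by (simp add: abs_le_iff)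
    moreover have "(\<eta>1 / 2 * \<rho> powr \<delta>) * (\<eta>1 * (L * \<rho>) powr \<delta>)
        \<le> (measure M ?B - a n) * measure M ?D"
    proof (rule mult_mono)
      show half: "\<eta>1 / 2 * \<rho> powr \<delta> \<le> measure M ?B - a n"
        using ball_lower[of \<rho> z] \<rho> a by simp
      show "\<eta>1 * (L * \<rho>) powr \<delta> \<le> measure M ?D"
        using \<rho> g(2) by (intro ball_lower) auto
      have "0 \<le> \<eta>1 / 2 * \<rho> powr \<delta>" using \<eta>1_pos by simp
      then show "0 \<le> measure M ?B - a n" using half by linarith
      show "0 \<le> \<eta>1 * (L * \<rho>) powr \<delta>" using \<eta>1_pos by simp
    qed
    ultimately show ?thesis by (simp add: algebra_simps)
  qed
  have disj: "disjoint_family_on (\<lambda>z. ball z \<rho> \<inter> ?E) C"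
    using disjoint_separated_balls[OF C(3)] unfolding disjoint_family_on_def by blast
  have "\<eta>1\<^sup>2 * L powr \<delta> / (2 * \<eta>2 * 2 powr \<delta>) * measure M (erosion U h) * \<rho> powr \<delta>
      \<le> \<eta>1\<^sup>2 * L powr \<delta> / (2 * \<eta>2 * 2 powr \<delta>) * (card C * (\<eta>2 * (2 powr \<delta> * \<rho> powr \<delta>))) * \<rho> powr \<delta>"
    using net \<eta>1_pos \<eta>2_pos by (intro mult_right_mono mult_left_mono) auto
  also have "\<dots> = (\<Sum>z\<in>C. (\<eta>1 / 2 * \<rho> powr \<delta>) * (\<eta>1 * (L * \<rho>) powr \<delta>))"
    using \<eta>2_pos \<rho> g(2) by (simp add: powr_mult power2_eq_square)
  also have "\<dots> \<le> (\<Sum>z\<in>C. measure M (ball z \<rho> \<inter> ?E))" by (intro sum_mono piece)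
  also have "\<dots> = measure M (\<Union>z\<in>C. ball z \<rho> \<inter> ?E)"
    using C(1) disj E
    by (intro finite_measure_finite_Union[symmetric] image_subsetI sets.Int ball_in_sets)
  also have "\<dots> \<le> measure M (U \<inter> ?E)"
  proof (rule finite_measure_mono)
    show "(\<Union>z\<in>C. ball z \<rho> \<inter> ?E) \<subseteq> U \<inter> ?E"
      using C(2) ball_subset_erosion[OF _ \<rho>(4), of _ U] by blast
    show "U \<inter> ?E \<in> sets M" by (intro sets.Int open_in_sets[OF U] E)
  qed
  finally show ?thesis .
qed

section \<open>Upper bounds for returns on one set expanded by an iterate\<close>

context
  fixes g :: "'a \<Rightarrow> 'a" and L K :: real and J :: "'a set" and m :: nat and r :: real
  assumes g: "L-lipschitz_on UNIV g" and L: "1 \<le> L" and KL: "2 * L \<le> K" and J: "J \<in> sets M"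
    and expand: "\<And>x y. x \<in> J \<Longrightarrow> y \<in> J \<Longrightarrow> K * dist x y \<le> dist ((T ^^ m) x) ((T ^^ m) y)"
    and r: "0 < r" "5 * r < r0"
begin

text \<open>The images of \<open>x\<close> and \<open>y\<close> differ by less than
  \<open>2 * r + L * dist x y\<close>. As \<open>K \<ge> 2 * L\<close>, the last term is at most
  half the distance of the images, and absorbing it leaves \<open>4 * r\<close>.\<close>

lemma return_event_diameter:
  assumes "x \<in> J \<inter> return_event g r m" "y \<in> J \<inter> return_event g r m"
  shows "dist x y < 4 * r / K" "dist ((T ^^ m) x) ((T ^^ m) y) < 4 * r"
proof -
  let ?S = "T ^^ m"
  have xy: "x \<in> J" "y \<in> J" "dist (?S x) (g x) < r" "dist (?S y) (g y) < r"
    using assms by (auto simp: return_event_def)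
  have "dist (?S x) (?S y) \<le> dist (?S x) (g x) + dist (g x) (g y) + dist (?S y) (g y)"
    using dist_triangle[of "?S x" "?S y" "g x"] dist_triangle2[of "g x" "?S y" "g y"] by linarith
  moreover have gl: "dist (g x) (g y) \<le> L * dist x y" using lipschitz_onD[OF g] by simp
  moreover have "L * dist x y \<le> K / 2 * dist x y" using KL by (intro mult_right_mono) auto
  moreover have "K * dist x y \<le> dist (?S x) (?S y)" using expand xy by blast
  ultimately have *: "K * dist x y < 4 * r" "dist (?S x) (?S y) < 4 * r" using xy by linarith+
  from * show "dist x y < 4 * r / K" "dist (?S x) (?S y) < 4 * r"
    using KL L by (auto simp: field_simps)
qed

lemma return_event_in_cylinder_le:
  "measure M (J \<inter> return_event g r m) \<le> \<eta>2 * 4 powr \<delta> * r powr \<delta> * K powr - \<delta>"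
proof -
  have "4 * r / K < r0"
  proof -
    have "4 * r / K \<le> 4 * r / 1" using KL L r by (intro divide_left_mono) auto
    then show ?thesis using r by linarith
  qed
  then have "measure M (J \<inter> return_event g r m) \<le> \<eta>2 * (4 * r / K) powr \<delta>"
    using J return_event_sets[OF g] return_event_diameter r KL L
    by (intro measure_le_diameter) auto
  also have "(4 * r / K) powr \<delta> = 4 powr \<delta> * r powr \<delta> * K powr - \<delta>"
    using r KL L by (simp add: powr_divide powr_mult powr_minus_divide)
  finally show ?thesis by (simp add: mult.assoc)
qed

text \<open>The image of \<open>J \<inter> E\<^sub>m\<close> under \<open>T\<^sup>m\<close> is cut into pieces of the scale \<open>min r s\<close>: on the preimage
  of each of them \<open>g\<close> is constant up to \<open>s\<close>, so that the second return becomes a visit to a fixed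
  ball, to which mixing applies.\<close>

lemma return_event_Int_in_cylinder_le:
  assumes "m < n" and s: "0 < s" "2 * L * s < r0"
  shows "measure M (J \<inter> (return_event g r m \<inter> return_event g s n))
    \<le> (\<eta>2 / \<eta>1)\<^sup>2 * 60 powr \<delta> * \<eta>2 * (2 * L) powr \<delta> * (\<eta>2 + 1)
      * (r powr \<delta> * s powr \<delta> + a (n - m) * (r powr \<delta> + s powr \<delta>)) * K powr - \<delta>"
proof -
  let ?S = "T ^^ m" and ?R = "T ^^ (n - m)"
  let ?E = "return_event g r m" and ?F = "return_event g s n"
  define q where "q = min r s"
  have q: "0 < q" "q \<le> r" "q \<le> s" "q < r0" using r s by (auto simp: q_def)
  have K: "1 \<le> K" "0 < K" using KL L by auto
  obtain C where C: "finite C" "C \<subseteq> ?S ` (J \<inter> ?E)" "pairwise (\<lambda>x y. q \<le> dist x y) C"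
    "?S ` (J \<inter> ?E) \<subseteq> (\<Union>u\<in>C. ball u q)"
    by (rule separated_net_exists[OF compact_UNIV q(1)])
  define Q where "Q = \<eta>2 / \<eta>1 * 10 powr \<delta>"
  have Q: "0 \<le> Q" using \<eta>1_pos \<eta>2_pos by (simp add: Q_def)
  \<comment> \<open>Net points are images of return points, hence within \<open>4 * r\<close> of
    each other, and all packing balls fit into one ball of radius \<open>5 * r\<close>. The 10 is
    the ratio of \<open>5 * r\<close> to \<open>r / 2\<close> after normalizing \<open>q\<close> to
    \<open>r\<close>.\<close>
  have card: "card C * q powr \<delta> \<le> Q * r powr \<delta>"
  proof (cases "C = {}")
    case False
    then obtain u0 where u0: "u0 \<in> C" by blast
    have "ball u (q / 2) \<subseteq> ball u0 (5 * r)" if "u \<in> C" for u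
    proof
      fix z assume z: "z \<in> ball u (q / 2)"
      have "u0 \<in> ?S ` (J \<inter> ?E)" "u \<in> ?S ` (J \<inter> ?E)" using C(2) u0 \<open>u \<in> C\<close> by auto
      then have "dist u0 u < 4 * r"
        by (elim imageE) (simp only: return_event_diameter(2))
      then show "z \<in> ball u0 (5 * r)"
        using z q dist_triangle[of u0 z u] by simp
    qed
    then have "card C * (\<eta>1 * (q / 2) powr \<delta>) \<le> measure M (ball u0 (5 * r))"
      using C(1,3) q by (intro card_separated_le) (auto intro: open_in_sets)
    also have "\<dots> \<le> \<eta>2 * (5 * r) powr \<delta>" using r by (intro ball_upper) auto
    also have "\<dots> = \<eta>2 * 5 powr \<delta> * r powr \<delta>" using r by (simp add: powr_mult)
    finally have "card C * q powr \<delta> \<le> (\<eta>2 / \<eta>1) * (5 powr \<delta> * 2 powr \<delta>) * r powr \<delta>"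
      using q \<eta>1_pos by (simp add: powr_divide field_simps)
    also have "5 powr \<delta> * 2 powr \<delta> = (10::real) powr \<delta>" by (simp flip: powr_mult)
    finally show ?thesis by (simp add: Q_def)
  qed (use Q in simp)
  \<comment> \<open>The mixing error is paid once per net point and carries the factor
    \<open>s powr \<delta>\<close>. If \<open>q = r\<close> the number of net points is bounded,
    otherwise \<open>q = s\<close> and the packing bound applies; the sum of the two powers covers
    both cases.\<close>
  have card': "card C * s powr \<delta> \<le> Q * (r powr \<delta> + s powr \<delta>)"
  proof (cases "r \<le> s")
    case True
    then have "card C * r powr \<delta> \<le> Q * r powr \<delta>" using card by (simp add: q_def)
    then have "card C \<le> Q" using r by simp
    then have "card C * s powr \<delta> \<le> Q * s powr \<delta>" by (intro mult_right_mono) auto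
    also have "\<dots> \<le> Q * (r powr \<delta> + s powr \<delta>)" using Q by (intro mult_left_mono) auto
    finally show ?thesis .
  next
    case False
    then have "card C * s powr \<delta> \<le> Q * r powr \<delta>" using card by (simp add: q_def)
    also have "\<dots> \<le> Q * (r powr \<delta> + s powr \<delta>)" using Q by (intro mult_left_mono) auto
    finally show ?thesis .
  qed
  have "\<exists>x. x \<in> J \<inter> ?E \<and> ?S x = u" if "u \<in> C" for u using C(2) that by blast
  then obtain \<xi> where \<xi>: "\<And>u. u \<in> C \<Longrightarrow> \<xi> u \<in> J \<inter> ?E" "\<And>u. u \<in> C \<Longrightarrow> ?S (\<xi> u) = u" by metis
  let ?A = "\<lambda>u. ball u q \<inter> ?R -` ball (g (\<xi> u)) (2 * L * s)"
  have A_sets: "?A u \<in> sets M" for u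
    by (intro sets.Int vimage_in_sets funpow_meas ball_in_sets)
  define c where "c = (\<eta>2 * q powr \<delta> + a (n - m)) * (\<eta>2 * ((2 * L) powr \<delta> * s powr \<delta>))"
  have A_le: "measure M (?A u) \<le> c" for u
  proof -
    let ?D = "ball (g (\<xi> u)) (2 * L * s)"
    have "measure M (?A u) \<le> (measure M (ball u q) + a (n - m)) * measure M ?D"
      using mixing[of q "2 * L * s" "n - m" u "g (\<xi> u)"] q s L \<open>m < n\<close>
      by (simp add: abs_le_iff algebra_simps)
    also have "\<dots> \<le> (\<eta>2 * q powr \<delta> + a (n - m)) * (\<eta>2 * (2 * L * s) powr \<delta>)"
      using ball_upper[of q u] ball_upper[of "2 * L * s" "g (\<xi> u)"] q s L a_nonneg[of "n - m"] \<eta>2_pos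
      by (intro mult_mono) auto
    finally show ?thesis using L s by (simp add: c_def powr_mult)
  qed
  define b where "b = \<eta>2 / \<eta>1 * 6 powr \<delta> * K powr - \<delta>"
  have b: "0 \<le> b" using \<eta>1_pos \<eta>2_pos by (simp add: b_def)
  have pull: "measure M (J \<inter> ?S -` ?A u) \<le> b * c" for u
  proof -
    have "measure M (J \<inter> ?S -` ?A u) \<le> b * measure M (?A u)"
      unfolding b_def by (rule measure_expanding_vimage_le[OF funpow_meas J K(2) expand A_sets])
    also have "\<dots> \<le> b * c" using A_le b by (intro mult_left_mono)
    finally show ?thesis .
  qed
  have pre_sets: "J \<inter> ?S -` ?A u \<in> sets M" for u
    by (intro sets.Int J vimage_in_sets[OF funpow_meas A_sets])
  \<comment> \<open>If the image of \<open>x\<close> lies within \<open>q \<le> s\<close> of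
    \<open>u\<close>, expansion puts \<open>x\<close> within \<open>s\<close> of
    \<open>\<xi> u\<close>. So \<open>g\<close> differs by at most \<open>L * s\<close> at the two
    points, and the second return of \<open>x\<close> to within \<open>s\<close> is a visit to the
    ball of radius \<open>2 * L * s\<close> about \<open>g (\<xi> u)\<close>.\<close>
  have sub: "J \<inter> (?E \<inter> ?F) \<subseteq> (\<Union>u\<in>C. J \<inter> ?S -` ?A u)"
  proof
    fix x assume x: "x \<in> J \<inter> (?E \<inter> ?F)"
    then have "?S x \<in> (\<Union>u\<in>C. ball u q)" using C(4) by blast
    then obtain u where u: "u \<in> C" "dist u (?S x) < q" by auto
    have "K * dist (\<xi> u) x \<le> dist (?S (\<xi> u)) (?S x)" using expand \<xi>(1)[OF u(1)] x by blast
    also have "\<dots> < s" using \<xi>(2)[OF u(1)] u(2) q by simp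
    finally have "K * dist (\<xi> u) x < s" .
    moreover have "1 * dist (\<xi> u) x \<le> K * dist (\<xi> u) x" using K by (intro mult_right_mono) auto
    ultimately have "dist (\<xi> u) x \<le> s" by simp
    then have "L * dist (\<xi> u) x \<le> L * s" using L by (intro mult_left_mono) auto
    moreover have "dist (g (\<xi> u)) (g x) \<le> L * dist (\<xi> u) x" using lipschitz_onD[OF g] by simp
    moreover have "?R (?S x) = (T ^^ n) x"
      using \<open>m < n\<close> by (simp flip: funpow_add comp_apply[of "?R" "?S"])
    moreover have "dist ((T ^^ n) x) (g x) < s" using x by (simp add: return_event_def)
    moreover have "s \<le> L * s" using L s by simp
    ultimately have "dist (g (\<xi> u)) (?R (?S x)) < 2 * L * s"
      using dist_triangle2[of "g (\<xi> u)" "?R (?S x)" "g x"] by simp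
    with u x show "x \<in> (\<Union>u\<in>C. J \<inter> ?S -` ?A u)" by auto
  qed
  have "measure M (J \<inter> (?E \<inter> ?F)) \<le> measure M (\<Union>u\<in>C. J \<inter> ?S -` ?A u)"
    using sub C(1) pre_sets by (intro finite_measure_mono sets.finite_UN)
  also have "\<dots> \<le> (\<Sum>u\<in>C. measure M (J \<inter> ?S -` ?A u))"
    using C(1) pre_sets by (intro finite_measure_subadditive_finite image_subsetI)
  also have "\<dots> \<le> (\<Sum>u\<in>C. b * c)" by (intro sum_mono pull)
  \<comment> \<open>The count of net points is grouped with \<open>q powr \<delta>\<close> in the
    main term and with \<open>s powr \<delta>\<close> in the error term, matching
    \<open>card\<close> and \<open>card'\<close>.\<close>
  also have "\<dots> = b * \<eta>2 * (2 * L) powr \<delta> *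
      (\<eta>2 * s powr \<delta> * (card C * q powr \<delta>) + a (n - m) * (card C * s powr \<delta>))"
    by (simp add: c_def algebra_simps)
  also have "\<dots> \<le> b * \<eta>2 * (2 * L) powr \<delta> *
      (\<eta>2 * s powr \<delta> * (Q * r powr \<delta>) + a (n - m) * (Q * (r powr \<delta> + s powr \<delta>)))"
    using card card' b \<eta>2_pos a_nonneg[of "n - m"]
    by (intro mult_left_mono add_mono) auto
  also have "\<dots> = b * \<eta>2 * (2 * L) powr \<delta> * Q *
      (\<eta>2 * (r powr \<delta> * s powr \<delta>) + 1 * (a (n - m) * (r powr \<delta> + s powr \<delta>)))"
    by (simp add: algebra_simps)
  also have "\<dots> \<le> b * \<eta>2 * (2 * L) powr \<delta> * Q *
      ((\<eta>2 + 1) * (r powr \<delta> * s powr \<delta>) + (\<eta>2 + 1) * (a (n - m) * (r powr \<delta> + s powr \<delta>)))"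
    using b Q \<eta>2_pos a_nonneg[of "n - m"]
    by (intro mult_left_mono add_mono mult_right_mono) auto
  also have "\<dots> = (\<eta>2 / \<eta>1)\<^sup>2 * (6 powr \<delta> * 10 powr \<delta>) * \<eta>2 * (2 * L) powr \<delta> * (\<eta>2 + 1)
      * (r powr \<delta> * s powr \<delta> + a (n - m) * (r powr \<delta> + s powr \<delta>)) * K powr - \<delta>"
    by (simp add: b_def Q_def power2_eq_square add_divide_distrib algebra_simps)
  also have "6 powr \<delta> * 10 powr \<delta> = (60::real) powr \<delta>" by (simp flip: powr_mult)
  finally show ?thesis .
qed

end

section \<open>Summation of local bounds over cylinders\<close>

lemma cylinder_sets:
  assumes "cylinder_base M T I X" "J \<in> cylinders T I X m"
  shows "J \<in> sets M"
proof -
  obtain w where w: "J = (\<Inter>k<m. (T ^^ k) -` X (w k))" "\<forall>k<m. w k \<in> I"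
    using assms(2) by (auto simp: cylinders_def)
  show ?thesis
  proof (cases "m = 0")
    case True
    then show ?thesis using w(1) sets.top[of M] by (simp add: space_M)
  next
    case False
    have "(T ^^ k) -` X (w k) \<in> sets M" if "k < m" for k
      using that w(2) assms(1)
      by (intro vimage_in_sets funpow_meas open_in_sets) (auto simp: cylinder_base_def)
    then show ?thesis unfolding w(1) using False by (intro sets.finite_INT) auto
  qed
qed

text \<open>Invariance of the measure carries the null complement of the sets \<open>X i\<close>
  back along every iterate. Almost every orbit thus stays in their union, and its itinerary is the
  required word.\<close>

lemma AE_in_cylinders:
  assumes base: "cylinder_base M T I X" and pres: "distr M M T = M"
  shows "AE x in M. x \<in> \<Union>(cylinders T I X m)"
proof -
  have "(\<Union>i\<in>I. X i) \<in> sets M"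
    using base by (intro open_in_sets) (auto simp: cylinder_base_def)
  then have "space M - (\<Union>i\<in>I. X i) \<in> null_sets M"
    using base by (auto simp: cylinder_base_def null_sets_def)
  then have start: "AE x in M. \<exists>i\<in>I. x \<in> X i" by (rule AE_I') auto
  have "AE x in M. \<exists>i\<in>I. (T ^^ k) x \<in> X i" for k
  proof (induction k)
    case (Suc k)
    then have "AE x in distr M M T. \<exists>i\<in>I. (T ^^ k) x \<in> X i" unfolding pres .
    then have "AE x in M. \<exists>i\<in>I. (T ^^ k) (T x) \<in> X i" by (rule AE_distrD[OF T_meas])
    then show ?case by (simp add: funpow_swap1)
  qed (use start in simp)
  then have "AE x in M. \<forall>k. \<exists>i\<in>I. (T ^^ k) x \<in> X i" by (simp add: AE_all_countable)
  then show ?thesis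
  proof (rule AE_mp, intro AE_I2 impI)
    fix x assume "\<forall>k. \<exists>i\<in>I. (T ^^ k) x \<in> X i"
    then obtain w where w: "\<And>k. w k \<in> I" "\<And>k. (T ^^ k) x \<in> X (w k)" by metis
    have "x \<in> (\<Inter>k<m. (T ^^ k) -` X (w k))" using w(2) by auto
    moreover have "(\<Inter>k<m. (T ^^ k) -` X (w k)) \<in> cylinders T I X m"
      using w(1) by (auto simp: cylinders_def)
    ultimately show "x \<in> \<Union>(cylinders T I X m)" by (rule UnionI[rotated])
  qed
qed

text \<open>Turns a bound proportional to the weight of each cylinder into a global one. Excluding
  expansion 0 makes \<open>neg_powr\<close> agree with the real power whenever the expansion is
  finite.\<close>

lemma measure_le_cylinder_sum:
  assumes base: "cylinder_base M T I X" and pres: "distr M M T = M" and E: "E \<in> sets M"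
    and pos: "\<And>J. J \<in> cylinders T I X m \<Longrightarrow> expansion T m J \<noteq> 0"
    and le: "\<And>J. J \<in> cylinders T I X m \<Longrightarrow> expansion T m J \<noteq> \<infinity> \<Longrightarrow>
      measure M (J \<inter> E) \<le> c * enn2real (expansion T m J) powr - \<delta>"
    and sum: "(\<Sum>\<^sub>\<infinity>J\<in>cylinders T I X m. neg_powr (expansion T m J) \<delta>) \<le> ennreal B"
    and "0 \<le> c" "0 \<le> B"
  shows "measure M E \<le> c * B"
proof -
  have "emeasure M E \<le> ennreal c * (\<Sum>\<^sub>\<infinity>J\<in>cylinders T I X m. neg_powr (expansion T m J) \<delta>)"
  proof (rule emeasure_le_sum_over_cover)
    show "countable (cylinders T I X m)"
      using base by (intro countable_cylinders) (simp add: cylinder_base_def)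
    show "cylinders T I X m \<subseteq> sets M" using cylinder_sets[OF base] by blast
    show "AE x in M. x \<in> \<Union>(cylinders T I X m)" by (rule AE_in_cylinders[OF base pres])
    fix J assume J: "J \<in> cylinders T I X m"
    let ?k = "enn2real (expansion T m J) powr - \<delta>"
    show "emeasure M (J \<inter> E) \<le> ennreal c * neg_powr (expansion T m J) \<delta>"
    proof (cases "expansion T m J = \<infinity>")
      case True
      \<comment> \<open>Infinite expansion means at most one point; the resulting measure 0 matches
        the value 0 of \<open>neg_powr\<close>.\<close>
      have "measure M (J \<inter> E) = 0"
        using cylinder_sets[OF base J] E expansion_infinite_subsingleton[OF True]
        by (intro measure_subsingleton) auto
      then show ?thesis by (simp add: emeasure_eq_measure)
    next
      case False
      then have "neg_powr (expansion T m J) \<delta> = ennreal ?k"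
        using pos[OF J] by (simp add: neg_powr_def)
      then have "ennreal c * neg_powr (expansion T m J) \<delta> = ennreal (c * ?k)"
        using \<open>0 \<le> c\<close> by (simp add: ennreal_mult')
      then show ?thesis
        using le[OF J False] by (simp add: emeasure_eq_measure ennreal_leI)
    qed
  qed fact
  also have "\<dots> \<le> ennreal c * ennreal B" by (intro mult_left_mono sum) auto
  finally show ?thesis
    using assms(7,8) by (simp add: emeasure_eq_measure flip: ennreal_mult)
qed

section \<open>Almost sure returns for Lipschitz maps\<close>

lemma AE_returns_lipschitz:
  assumes base: "cylinder_base M T I X" and pres: "distr M M T = M" and exp: "expanding T I X \<delta>"
    and g0: "L0-lipschitz_on UNIV g"
    and \<psi>: "\<And>n. 1 \<le> n \<Longrightarrow> 0 < \<psi> n" "\<psi> \<longlonglongrightarrow> 0" "\<not> summable (\<lambda>n. \<psi> (Suc n) powr \<delta>)"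
  shows "AE x in M. infinite {n. 1 \<le> n \<and> dist ((T ^^ n) x) (g x) < \<psi> n}"
proof -
  define L where "L = max 1 L0"
  have L: "1 \<le> L" "0 < L" by (auto simp: L_def)
  have g: "L-lipschitz_on UNIV g" using g0 by (rule lipschitz_on_mono) (auto simp: L_def)
  define p where "p n = \<psi> n powr \<delta>" for n
  define E where "E n = return_event g (\<psi> n) n" for n
  have E: "E n \<in> sets M" for n unfolding E_def by (rule return_event_sets[OF g])
  define B where "B = enn2real (SUP m\<in>{1..}. \<Sum>\<^sub>\<infinity>J\<in>cylinders T I X m. neg_powr (expansion T m J) \<delta>)"
  have B: "0 \<le> B" by (simp add: B_def)
  have sum_le: "(\<Sum>\<^sub>\<infinity>J\<in>cylinders T I X m. neg_powr (expansion T m J) \<delta>) \<le> ennreal B" if "1 \<le> m" for m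
  proof -
    have "ennreal B = (SUP m\<in>{1..}. \<Sum>\<^sub>\<infinity>J\<in>cylinders T I X m. neg_powr (expansion T m J) \<delta>)"
      unfolding B_def using exp by (intro ennreal_enn2real) (auto simp: expanding_def)
    moreover have "(\<Sum>\<^sub>\<infinity>J\<in>cylinders T I X m. neg_powr (expansion T m J) \<delta>)
      \<le> (SUP m\<in>{1..}. \<Sum>\<^sub>\<infinity>J\<in>cylinders T I X m. neg_powr (expansion T m J) \<delta>)"
      using that by (intro SUP_upper) auto
    ultimately show ?thesis by simp
  qed
  \<comment> \<open>Past this threshold the expansion dominates \<open>2 * L\<close> and the radii
    \<open>5 * \<psi> n\<close> and \<open>2 * L * \<psi> n\<close> are below \<open>r0\<close>, as
    the estimates on one cylinder demand.\<close>
  have ev: "eventually (\<lambda>n. 1 \<le> n \<and> ennreal (2 * L) < (INF J\<in>cylinders T I X n. expansion T n J)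
      \<and> \<psi> n < r0 / 5 \<and> \<psi> n < r0 / (2 * L)) sequentially"
  proof (intro eventually_conj)
    show "eventually (\<lambda>n. ennreal (2 * L) < (INF J\<in>cylinders T I X n. expansion T n J)) sequentially"
      using exp unfolding expanding_def by (intro order_tendstoD(1)) auto
    show "eventually (\<lambda>n. \<psi> n < r0 / 5) sequentially"
      "eventually (\<lambda>n. \<psi> n < r0 / (2 * L)) sequentially"
      using \<psi>(2) r0_pos L by (auto intro!: order_tendstoD(2))
  qed (rule eventually_ge_at_top)
  then obtain N0 where N0: "\<And>n. N0 \<le> n \<Longrightarrow> 1 \<le> n"
    "\<And>n. N0 \<le> n \<Longrightarrow> ennreal (2 * L) < (INF J\<in>cylinders T I X n. expansion T n J)"
    "\<And>n. N0 \<le> n \<Longrightarrow> \<psi> n < r0 / 5" "\<And>n. N0 \<le> n \<Longrightarrow> \<psi> n < r0 / (2 * L)"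
    unfolding eventually_sequentially by blast
  have small: "0 < \<psi> n" "5 * \<psi> n < r0" "2 * L * \<psi> n < r0" if "N0 \<le> n" for n
    using N0(1,3,4)[OF that] \<psi>(1)[of n] L by (auto simp: field_simps)
  have exp_ge: "ennreal (2 * L) \<le> expansion T m J" if "N0 \<le> m" "J \<in> cylinders T I X m" for m J
    using N0(2)[OF that(1)] INF_lower[OF that(2), of "expansion T m"] by simp
  have exp_pos: "expansion T m J \<noteq> 0" if "N0 \<le> m" "J \<in> cylinders T I X m" for m J
    using exp_ge[OF that] L by auto
  have exp_real: "2 * L \<le> enn2real (expansion T m J)"
    if "N0 \<le> m" "J \<in> cylinders T I X m" "expansion T m J \<noteq> \<infinity>" for m J
    using enn2real_mono[OF exp_ge[OF that(1,2)]] that(3) L by (simp add: less_top)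
  \<comment> \<open>With \<open>\<rho> = \<psi> n / (2 * L)\<close>, the condition
    \<open>a n \<le> \<epsilon> * p n\<close> is exactly the one that
    \<open>return_event_lower\<close> places on the mixing error.\<close>
  define \<epsilon> where "\<epsilon> = \<eta>1 / 2 * (2 * L) powr - \<delta>"
  have \<epsilon>: "0 < \<epsilon>" using \<eta>1_pos L by (simp add: \<epsilon>_def)
  define G where "G = {n. N0 \<le> n \<and> a n \<le> \<epsilon> * p n}"
  have G: "n \<in> G \<Longrightarrow> N0 \<le> n" "n \<in> G \<Longrightarrow> a n \<le> \<epsilon> * p n" for n by (auto simp: G_def)
  \<comment> \<open>Beyond \<open>N0\<close>, an index outside \<open>G\<close> has
    \<open>p n < a n / \<epsilon>\<close>, so the discarded terms are summable and the divergence
    stays on \<open>G\<close>.\<close>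
  have div: "\<not> summable (\<lambda>n. if n \<in> G then p n else 0)"
  proof
    assume "summable (\<lambda>n. if n \<in> G then p n else 0)"
    then have "summable (\<lambda>n. (if n \<in> G then p n else 0) + a n / \<epsilon>)"
      using a_summable by (intro summable_add summable_divide)
    then have "summable p"
    proof (rule summable_comparison_test'[where N = N0])
      fix n assume "N0 \<le> n"
      then show "norm (p n) \<le> (if n \<in> G then p n else 0) + a n / \<epsilon>"
        using a_nonneg[of n] \<epsilon> by (auto simp: G_def p_def field_simps)
    qed
    then have "summable (\<lambda>n. p (Suc n))" by (simp add: summable_Suc_iff)
    then show False using \<psi>(3) by (simp add: p_def)
  qed
  define c where "c = \<eta>1\<^sup>2 * L powr \<delta> / (2 * \<eta>2 * 2 powr \<delta>) * (2 * L) powr - \<delta>"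
  have c: "0 < c" using \<eta>1_pos \<eta>2_pos L by (simp add: c_def)
  have lower: "c * measure M (erosion U h) * p n \<le> measure M (U \<inter> E n)"
    if U: "open U" and n: "n \<in> G" "\<psi> n \<le> h" for U h n
  proof -
    let ?\<rho> = "\<psi> n / (2 * L)"
    have s: "0 < \<psi> n" "5 * \<psi> n < r0" using small[OF G(1)[OF n(1)]] by auto
    have \<rho>: "?\<rho> powr \<delta> = (2 * L) powr - \<delta> * p n"
      using s(1) L by (simp add: p_def powr_divide powr_minus_divide)
    have "?\<rho> \<le> \<psi> n / 2" using s L by (intro divide_left_mono) auto
    then have "\<eta>1\<^sup>2 * L powr \<delta> / (2 * \<eta>2 * 2 powr \<delta>) * measure M (erosion U h) * ?\<rho> powr \<delta>
        \<le> measure M (U \<inter> return_event g (2 * L * ?\<rho>) n)"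
      using s L n(2) G[OF n(1)] N0(1)[OF G(1)[OF n(1)]]
      by (intro return_event_lower[OF g L(2) _ U]) (auto simp: \<rho> \<epsilon>_def simp del: times_divide_eq_left)
    then show ?thesis using L unfolding \<rho> by (simp add: c_def E_def algebra_simps)
  qed
  define C1 where "C1 = \<eta>2 * 4 powr \<delta>"
  define C2 where "C2 = (\<eta>2 / \<eta>1)\<^sup>2 * 60 powr \<delta> * \<eta>2 * (2 * L) powr \<delta> * (\<eta>2 + 1)"
  have C12: "0 < C1" "0 < C2" using \<eta>1_pos \<eta>2_pos L by (auto simp: C1_def C2_def)
  have upper: "measure M (E m) \<le> C1 * p m * B" if "m \<in> G" for m
  proof (rule measure_le_cylinder_sum[OF base pres E])
    fix J assume J: "J \<in> cylinders T I X m" "expansion T m J \<noteq> \<infinity>"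
    show "measure M (J \<inter> E m) \<le> C1 * p m * enn2real (expansion T m J) powr - \<delta>"
      unfolding E_def C1_def p_def
      using small[OF G(1)[OF that]] exp_real[OF G(1)[OF that] J] J
      by (intro return_event_in_cylinder_le[OF g L(1)] cylinder_sets[OF base] expansion_finite_le)
        auto
  qed (use G(1)[OF that] N0(1) exp_pos C12 B in \<open>auto simp: p_def intro: sum_le\<close>)
  have pair: "measure M (E m \<inter> E n) \<le> C2 * (p m * p n + a (n - m) * (p m + p n)) * B"
    if mn: "m \<in> G" "n \<in> G" "m < n" for m n
  proof (rule measure_le_cylinder_sum[OF base pres sets.Int[OF E E]])
    fix J assume J: "J \<in> cylinders T I X m" "expansion T m J \<noteq> \<infinity>"
    show "measure M (J \<inter> (E m \<inter> E n))
        \<le> C2 * (p m * p n + a (n - m) * (p m + p n)) * enn2real (expansion T m J) powr - \<delta>"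
      unfolding E_def C2_def p_def
      using small[OF G(1)[OF mn(1)]] small[OF G(1)[OF mn(2)]] exp_real[OF G(1)[OF mn(1)] J] J mn(3)
      by (intro return_event_Int_in_cylinder_le[OF g L(1)] cylinder_sets[OF base] expansion_finite_le)
        auto
  qed (use G(1)[OF mn(1)] N0(1) exp_pos C12 B a_nonneg[of "n - m"] in
      \<open>auto simp: p_def intro: sum_le\<close>)
  \<comment> \<open>One constant for single and pair events; the summand 1 keeps it positive even if
    \<open>B\<close> is 0.\<close>
  define C where "C = (C1 + C2) * (B + 1)"
  have C: "0 < C" "C1 * B \<le> C" "C2 * B \<le> C"
    using C12 B mult_nonneg_nonneg[of C1 B] mult_nonneg_nonneg[of C2 B]
    by (auto simp: C_def distrib_left distrib_right intro!: add_nonneg_pos)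
  have "AE x in M. infinite {n\<in>G. x \<in> E n}"
  proof (rule AE_infinitely_often_if_quasi_independent[OF prob_space_axioms sets_M E _ a_nonneg
        a_summable div c C(1)])
    show "0 \<le> p n" for n by (simp add: p_def)
    show "\<exists>k. \<forall>n\<in>G. k \<le> n \<longrightarrow> c * t * p n \<le> measure M (U \<inter> E n)"
      if U: "open U" and t: "0 < t" "t < measure M U" for U t
    proof -
      \<comment> \<open>Some erosion of \<open>U\<close> still has measure above \<open>t\<close>;
        once \<open>\<psi> n\<close> is below its depth, \<open>lower\<close> applies with that
        fixed depth.\<close>
      have "(\<lambda>j. measure M (erosion U (1 / real (Suc j)))) \<longlonglongrightarrow> measure M U"
        using finite_Lim_measure_incseq[of "\<lambda>j. erosion U (1 / real (Suc j))"] incseq_erosion[of U]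
          closed_in_sets[OF closed_erosion] unfolding UN_erosion[OF U] by blast
      then have "eventually (\<lambda>j. t < measure M (erosion U (1 / real (Suc j)))) sequentially"
        using t(2) by (rule order_tendstoD)
      then obtain j where j: "t < measure M (erosion U (1 / real (Suc j)))"
        by (auto simp: eventually_sequentially)
      have "eventually (\<lambda>n. \<psi> n < 1 / real (Suc j)) sequentially"
        using \<psi>(2) by (rule order_tendstoD) simp
      then obtain k where k: "\<And>n. k \<le> n \<Longrightarrow> \<psi> n < 1 / real (Suc j)"
        by (auto simp: eventually_sequentially)
      have "c * t * p n \<le> measure M (U \<inter> E n)" if n: "n \<in> G" "k \<le> n" for n
      proof -
        have "c * t * p n \<le> c * measure M (erosion U (1 / real (Suc j))) * p n"
          using j c by (intro mult_right_mono mult_left_mono) (auto simp: p_def)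
        also have "\<dots> \<le> measure M (U \<inter> E n)"
          using k[OF n(2)] by (intro lower U n(1)) simp
        finally show ?thesis .
      qed
      then show ?thesis by blast
    qed
    show "measure M (E n) \<le> C * p n" if "n \<in> G" for n
    proof -
      have "measure M (E n) \<le> C1 * B * p n" using upper[OF that] by (simp add: algebra_simps)
      also have "\<dots> \<le> C * p n" using C(2) by (intro mult_right_mono) (auto simp: p_def)
      finally show ?thesis .
    qed
    show "measure M (E m \<inter> E n) \<le> C * (p m * p n + a (n - m) * (p m + p n))"
      if "m \<in> G" "n \<in> G" "m < n" for m n
    proof -
      have "measure M (E m \<inter> E n) \<le> C2 * B * (p m * p n + a (n - m) * (p m + p n))"
        using pair[OF that] by (simp add: algebra_simps)
      also have "\<dots> \<le> C * (p m * p n + a (n - m) * (p m + p n))"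
        using C(3) a_nonneg by (intro mult_right_mono) (auto simp: p_def)
      finally show ?thesis .
    qed
  qed
  then show ?thesis
  proof (rule AE_mp, intro AE_I2 impI)
    fix x assume "infinite {n\<in>G. x \<in> E n}"
    moreover have "{n\<in>G. x \<in> E n} \<subseteq> {n. 1 \<le> n \<and> dist ((T ^^ n) x) (g x) < \<psi> n}"
      using G(1) N0(1) by (auto simp: E_def return_event_def)
    ultimately show "infinite {n. 1 \<le> n \<and> dist ((T ^^ n) x) (g x) < \<psi> n}"
      using finite_subset by blast
  qed
qed

end

section \<open>Passage to piecewise Lipschitz maps and to the completed measure\<close>

theorem theorem1p4:
  fixes M :: "'a::metric_space measure"
    and T f :: "'a \<Rightarrow> 'a"
    and I :: "'i set"
    and X :: "'i \<Rightarrow> 'a set"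
    and \<delta> :: real
    and \<psi> :: "nat \<Rightarrow> real"
  assumes "compact (UNIV :: 'a set)"
    and "borel_pmp_system M T"
    and "cylinder_base M T I X"
    and "\<delta> > 0"
    and "ahlfors_regular M \<delta>"
    and "uniformly_mixing M T"
    and "bounded_distortion T I X"
    and "expanding T I X \<delta>"
    and "conformal T I X"
    and "\<And>n. n \<ge> 1 \<Longrightarrow> \<psi> n > 0"
    and "\<psi> \<longlonglongrightarrow> 0"
    and "piecewise_lipschitz M f"
    and "T \<circ> f = f \<circ> T"
    and "\<not> summable (\<lambda>n. \<psi> (Suc n) powr \<delta>)"
  shows "emeasure (completion M) (recurrence_set T f \<psi>) = 1"
proof -
  have pmp: "prob_space M" "sets M = sets borel" "T \<in> measurable M M" "distr M M T = M"
    using assms(2) by (auto simp: borel_pmp_system_def)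
  obtain \<eta>1 \<eta>2 r0 where ahlfors: "0 < \<eta>1" "0 < \<eta>2" "0 < r0"
    "\<And>x r. 0 < r \<Longrightarrow> r < r0 \<Longrightarrow>
      \<eta>1 * r powr \<delta> \<le> measure M (ball x r) \<and> measure M (ball x r) \<le> \<eta>2 * r powr \<delta>"
    using assms(5) unfolding ahlfors_regular_def by blast
  obtain b where b: "\<And>n. 1 \<le> n \<Longrightarrow> 0 < b n" "summable (\<lambda>n. b (Suc n))"
    "\<And>x r y s n. 0 < r \<Longrightarrow> 0 < s \<Longrightarrow> 1 \<le> n \<Longrightarrow>
      \<bar>measure M (ball x r \<inter> (T ^^ n) -` ball y s) - measure M (ball x r) * measure M (ball y s)\<bar>
        \<le> b n * measure M (ball y s)"
    using assms(6) unfolding uniformly_mixing_def by blast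
  \<comment> \<open>The mixing sequence is unconstrained at index 0; the value 0 there makes the
    extension nonnegative and summable over all of \<open>nat\<close>.\<close>
  define a where "a n = (if n = 0 then 0 else b n)" for n
  interpret prob_space M by fact
  interpret mixing_system M \<delta> \<eta>1 \<eta>2 r0 T a
  proof
    show "0 \<le> a n" for n using b(1)[of n] by (auto simp: a_def less_imp_le)
    have "summable (\<lambda>n. a (Suc n))" using b(2) by (simp add: a_def)
    then show "summable a" by (simp add: summable_Suc_iff)
    show "\<bar>measure M (ball x r \<inter> (T ^^ n) -` ball y s) - measure M (ball x r) * measure M (ball y s)\<bar>
        \<le> a n * measure M (ball y s)" if "0 < r" "0 < s" "1 \<le> n" for x r y s n
      using b(3)[OF that] that(3) by (simp add: a_def)
  qed (use ahlfors pmp assms(1,4) in auto)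
  obtain N :: "nat set" and Y :: "nat \<Rightarrow> 'a set" and g :: "nat \<Rightarrow> 'a \<Rightarrow> 'a" where
    Y: "\<And>i. i \<in> N \<Longrightarrow> Y i \<in> sets M" and lip: "\<And>i. i \<in> N \<Longrightarrow> \<exists>L. L-lipschitz_on UNIV (g i)"
    and fg: "\<And>i x. i \<in> N \<Longrightarrow> x \<in> Y i \<Longrightarrow> f x = g i x"
    and null: "emeasure M (space M - (\<Union>i\<in>N. Y i)) = 0"
    using assms(12) unfolding piecewise_lipschitz_def by blast
  have "AE x in M. infinite {n. 1 \<le> n \<and> dist ((T ^^ n) x) (g i x) < \<psi> n}" if "i \<in> N" for i
  proof -
    obtain L where "L-lipschitz_on UNIV (g i)" using lip \<open>i \<in> N\<close> by blast
    then show ?thesis using assms(3,8,10,11,14) pmp(4) by (intro AE_returns_lipschitz)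
  qed
  then have "AE x in M. \<forall>i\<in>N. infinite {n. 1 \<le> n \<and> dist ((T ^^ n) x) (g i x) < \<psi> n}"
    by (subst AE_ball_countable) auto
  moreover have "space M - (\<Union>i\<in>N. Y i) \<in> null_sets M"
    using null Y by (auto simp: null_sets_def)
  then have "AE x in M. x \<in> (\<Union>i\<in>N. Y i)" by (rule AE_I') auto
  \<comment> \<open>Almost every point lies in some \<open>Y i\<close> and returns infinitely often
    for all the countably many \<open>g i\<close> at once, in particular for the one that agrees
    with \<open>f\<close> at that point.\<close>
  ultimately have "AE x in M. x \<in> recurrence_set T f \<psi>"
    by eventually_elim (auto simp: recurrence_set_def fg)
  then obtain Z where Z: "Z \<in> null_sets M" "{x \<in> space M. x \<notin> recurrence_set T f \<psi>} \<subseteq> Z"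
    unfolding eventually_ae_filter by auto
  let ?Z = "UNIV - recurrence_set T f \<psi>"
  \<comment> \<open>The exceptional set need not be Borel; it is only known to lie in the null set
    \<open>Z\<close>, which suffices in the completion.\<close>
  have "?Z \<in> null_sets (completion M)"
    using Z unfolding null_sets_completion_iff2 by (intro bexI[of _ Z]) (auto simp: space_M)
  moreover have "UNIV \<in> sets (completion M)"
    using sets.top[of "completion M"] by (simp add: space_M)
  ultimately have "emeasure (completion M) (UNIV - ?Z) = emeasure (completion M) UNIV"
    by (intro emeasure_Diff_null_set)
  also have "\<dots> = emeasure M UNIV"
    using sets.top[of M] by (simp add: space_M)
  also have "\<dots> = 1" using emeasure_space_1 by (simp add: space_M)
  finally show ?thesis by (simp add: double_diff)
qed

end
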